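(* Let $M(\omega)$, $\omega\in\Omega$, be a random reduced dynamics operator on $\mathbb{C}^d$ with probability space $(\Omega,\mathcal{F},\mathrm{p})$, and suppose that $\mathrm{p}(M(\omega)\in\mathcal{M}_{(E)})>0$. Then there exists a set $\Omega_3\subset\Omega^{\mathbb{N}^*}$ with $\mathbb{P}(\Omega_3)=1$ such that for all $\overline\omega=(\omega_j)_{j\ge1}\in\Omega_3$, $$\lim_{N\to\infty}\frac1N\sum_{n=1}^N M(\omega_1)M(\omega_2)\cdots M(\omega_n)=|\psi_{\mathcal S}\rangle\langle\theta|=P_{1,\mathbb{E}[M]},$$ where $\theta=(\mathbf{1}-\mathbb{E}[M_Q]^* )^{-1}\mathbb{E}[\psi]=P_{1,\mathbb{E}[M]}^*\mathbb{E}[\psi]=P_{1,\mathbb{E}[M]}^*\psi_{\mathcal S}$.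
   Context: Inner products on $\mathbb{C}^d$ are linear in the second factor; $\|\cdot\|$ is the Euclidean norm and the induced operator norm; $|\psi\rangle\langle\phi|$ denotes $\chi\mapsto\langle\phi,\chi\rangle\psi$. $\mathbb{N}^*=\{1,2,\dots\}$. A random reduced dynamics operator (RRDO) is a measurable map $\omega\mapsto M(\omega)\in M_d(\mathbb{C})$ on a probability space $(\Omega,\mathcal{F},\mathrm{p})$ such that: (1) there is a norm $|||\cdot|||$ on $\mathbb{C}^d$ (independent of $\omega$) for which every $M(\omega)$ is a contraction; (2) there is a vector $\psi_{\mathcal S}$, independent of $\omega$, normalized by $\|\psi_{\mathcal S}\|=1$, with $M(\omega)\psi_{\mathcal S}=\psi_{\mathcal S}$ for all $\omega$. $\mathcal{M}_{(E)}$ is the set of matrices $M$ with $|||M|||\le1$ and $M\psi_{\mathcal S}=\psi_{\mathcal S}$ whose spectrum on the complex unit circle consists only of the simple eigenvalue $1$. Let $P_1(\omega)$ be the spectral (Riesz) projection of $M(\omega)$ for the eigenvalue $1$; set $\psi(\omega)=P_1(\omega)^*\psi_{\mathcal S}$, $P(\omega)=|\psi_{\mathcal S}\rangle\langle\psi(\omega)|$, $Q(\omega)=\mathbf{1}-P(\omega)$, and $M_Q(\omega)=Q(\omega)M(\omega)Q(\omega)$; one has $M(\omega)=P(\omega)+M_Q(\omega)$. $\mathbb{P}=\prod_{j\ge1}\mathrm{p}$ is the product probability measure on $\Omega^{\mathbb{N}^*}$. For a random variable $f$ on $\Omega$, $\mathbb{E}[f]=\int_\Omega f\,d\mathrm{p}$.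 $P_{1,\mathbb{E}[M]}$ is the spectral projection of $\mathbb{E}[M]$ for the eigenvalue $1$. *)

theory Defs
  imports "HOL-Probability.Probability" "HOL-Complex_Analysis.Complex_Analysis"
begin

definition cinner :: "complex^'n \<Rightarrow> complex^'n \<Rightarrow> complex" where
  "cinner x y = (\<Sum>i\<in>UNIV. cnj (x $ i) * y $ i)"

definition ketbra :: "complex^'n \<Rightarrow> complex^'n \<Rightarrow> complex^'n^'n" where
  "ketbra \<psi> \<phi> = matrix (\<lambda>x. cinner \<phi> x *s \<psi>)"

definition adj :: "complex^'n^'n \<Rightarrow> complex^'n^'n" where
  "adj A = (\<chi> i j. cnj (A $ j $ i))"

lemma ketbra_mult_vec: "ketbra \<psi> \<phi> *v x = cinner \<phi> x *s \<psi>"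
  by (simp add: vec_eq_iff ketbra_def matrix_def matrix_vector_mult_def cinner_def axis_def
      if_distrib[of "\<lambda>x. _ * x"] sum_distrib_left mult_ac cong: if_cong)

lemma cinner_adj: "cinner (adj A *v x) y = cinner x (A *v y)"
proof -
  have "cinner (adj A *v x) y = (\<Sum>i\<in>UNIV. \<Sum>j\<in>UNIV. A $ j $ i * cnj (x $ j) * y $ i)"
    by (simp add: cinner_def adj_def matrix_vector_mult_def sum_distrib_right)
  also have "\<dots> = (\<Sum>j\<in>UNIV. \<Sum>i\<in>UNIV. A $ j $ i * cnj (x $ j) * y $ i)"
    by (rule sum.swap)
  also have "\<dots> = cinner x (A *v y)"
    by (simp add: cinner_def matrix_vector_mult_def sum_distrib_left mult_ac)
  finally show ?thesis .
qed

definition is_norm :: "(complex^'n \<Rightarrow> real) \<Rightarrow> bool" where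
  "is_norm \<nu> \<longleftrightarrow>
     (\<forall>x. 0 \<le> \<nu> x) \<and>
     (\<forall>x. \<nu> x = 0 \<longleftrightarrow> x = 0) \<and>
     (\<forall>c x. \<nu> (c *s x) = cmod c * \<nu> x) \<and>
     (\<forall>x y. \<nu> (x + y) \<le> \<nu> x + \<nu> y)"

text \<open>That the operator norm induced by \<open>\<nu>\<close> is at most 1.\<close>

definition contraction :: "(complex^'n \<Rightarrow> real) \<Rightarrow> complex^'n^'n \<Rightarrow> bool" where
  "contraction \<nu> A \<longleftrightarrow> (\<forall>x. \<nu> (A *v x) \<le> \<nu> x)"

definition is_eigenvalue :: "complex^'n^'n \<Rightarrow> complex \<Rightarrow> bool" where
  "is_eigenvalue A c \<longleftrightarrow> (\<exists>v. v \<noteq> 0 \<and> A *v v = c *s v)"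

text \<open>Algebraic multiplicity, as the complex dimension of the generalized eigenspace.\<close>

definition alg_mult :: "complex^'n^'n \<Rightarrow> complex \<Rightarrow> nat" where
  "alg_mult A c = vec.dim {v. \<exists>k. ((\<lambda>w. A *v w - c *s w) ^^ k) v = 0}"

text \<open>
  The Riesz projection, the integral of the resolvent (divided by \<open>2 \<pi> i\<close>) over a circle around
  \<open>c\<close> which neither meets nor encloses any other eigenvalue. It does not depend on the radius
  chosen. The matrix-valued integral is taken entrywise; \<open>mat z\<close> is \<open>z\<close> times the identity.
\<close>

definition riesz_projection :: "complex^'n^'n \<Rightarrow> complex \<Rightarrow> complex^'n^'n" where
  "riesz_projection A c =
     (let r = (SOME r. 0 < r \<and> (\<forall>z. is_eigenvalue A z \<and> z \<noteq> c \<longrightarrow> r < dist c z))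
      in \<chi> i j. contour_integral (circlepath c r) (\<lambda>z. matrix_inv (mat z - A) $ i $ j)
                 / (2 * of_real pi * \<i>))"

definition RRDO ::
  "'a measure \<Rightarrow> (complex^'n \<Rightarrow> real) \<Rightarrow> complex^'n \<Rightarrow> ('a \<Rightarrow> complex^'n^'n) \<Rightarrow> bool" where
  "RRDO p \<nu> \<psi>\<^sub>S M \<longleftrightarrow>
     prob_space p \<and> M \<in> borel_measurable p \<and>
     is_norm \<nu> \<and> (\<forall>\<omega>\<in>space p. contraction \<nu> (M \<omega>)) \<and>
     norm \<psi>\<^sub>S = 1 \<and> (\<forall>\<omega>\<in>space p. M \<omega> *v \<psi>\<^sub>S = \<psi>\<^sub>S)"

definition M_E :: "(complex^'n \<Rightarrow> real) \<Rightarrow> complex^'n \<Rightarrow> (complex^'n^'n) set" where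
  "M_E \<nu> \<psi>\<^sub>S =
     {A. contraction \<nu> A \<and> A *v \<psi>\<^sub>S = \<psi>\<^sub>S \<and>
         {z. is_eigenvalue A z \<and> cmod z = 1} = {1} \<and> alg_mult A 1 = 1}"

text \<open>
  For a single matrix \<open>A = M(\<omega>)\<close>: the vector \<open>\<psi>(\<omega>)\<close>, the projections \<open>P(\<omega>)\<close> and \<open>Q(\<omega>)\<close>, and
  \<open>M\<^sub>Q(\<omega>)\<close>.
\<close>

definition psi_of :: "complex^'n \<Rightarrow> complex^'n^'n \<Rightarrow> complex^'n" where
  "psi_of \<psi>\<^sub>S A = adj (riesz_projection A 1) *v \<psi>\<^sub>S"

definition P_of :: "complex^'n \<Rightarrow> complex^'n^'n \<Rightarrow> complex^'n^'n" where
  "P_of \<psi>\<^sub>S A = ketbra \<psi>\<^sub>S (psi_of \<psi>\<^sub>S A)"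

definition Q_of :: "complex^'n \<Rightarrow> complex^'n^'n \<Rightarrow> complex^'n^'n" where
  "Q_of \<psi>\<^sub>S A = mat 1 - P_of \<psi>\<^sub>S A"

definition MQ_of :: "complex^'n \<Rightarrow> complex^'n^'n \<Rightarrow> complex^'n^'n" where
  "MQ_of \<psi>\<^sub>S A = Q_of \<psi>\<^sub>S A ** A ** Q_of \<psi>\<^sub>S A"

text \<open>\<open>M(\<omega>\<^sub>1) M(\<omega>\<^sub>2) \<cdots> M(\<omega>\<^sub>n)\<close>, each new factor being multiplied on the right.\<close>

primrec mat_prod :: "('a \<Rightarrow> complex^'n^'n) \<Rightarrow> (nat \<Rightarrow> 'a) \<Rightarrow> nat \<Rightarrow> complex^'n^'n" where
  "mat_prod M w 0 = mat 1"
| "mat_prod M w (Suc n) = mat_prod M w n ** M (w (Suc n))"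

end

theory Submission
  imports Defs
begin

text \<open>
  Write \<open>A = \<E>[M]\<close> and \<open>X\<^sub>n = M(\<omega>\<^sub>1) \<cdots> M(\<omega>\<^sub>n)\<close>. Since \<open>X\<^sub>n - X\<^bsub>n-1\<^esub> A\<close>
  are bounded martingale differences, their averages tend to 0 almost surely, so the averages
  \<open>Y\<^sub>N\<close> of the \<open>X\<^sub>n\<close> satisfy \<open>Y\<^sub>N (1 - A) \<longlonglongrightarrow> 0\<close>. Moreover \<open>Y\<^sub>N \<psi>\<^sub>S = \<psi>\<^sub>S\<close> and
  \<open>1 - \<E>[M\<^sub>Q] = 1 - A + |\<psi>\<^sub>S\<rangle>\<langle>\<E>[\<psi>]|\<close>, hence \<open>Y\<^sub>N (1 - \<E>[M\<^sub>Q]) \<longlonglongrightarrow> |\<psi>\<^sub>S\<rangle>\<langle>\<E>[\<psi>]|\<close>, and it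
  remains to invert \<open>1 - \<E>[M\<^sub>Q]\<close>. This is possible because \<open>A\<close> fixes only the multiples of
  \<open>\<psi>\<^sub>S\<close>: with positive weight \<open>A\<close> is an average of matrices close to some \<open>M\<^sub>0\<close> in \<open>M_E\<close>, whose
  Cesaro means approach a projection onto the line of \<open>\<psi>\<^sub>S\<close>. Riesz projections are handled
  throughout as limits of Cesaro means, which yields their measurability and boundedness.
\<close>

section \<open>Complex matrices and the sesquilinear form\<close>

no_notation fps_nth (infixl "$" 75)

lemma bounded_bilinear_matrix_vector_mult:
  "bounded_bilinear ((*v) :: complex^'m^'n \<Rightarrow> complex^'m \<Rightarrow> complex^'n)"
  by (rule bilinear_conv_bounded_bilinear[THEN iffD1])
    (auto simp: bilinear_def vec_eq_iff matrix_vector_mult_def sum.distrib algebra_simps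
      scaleR_sum_right intro!: linearI)

lemma bounded_bilinear_matrix_matrix_mult:
  "bounded_bilinear ((**) :: complex^'m^'n \<Rightarrow> complex^'k^'m \<Rightarrow> complex^'k^'n)"
  by (rule bilinear_conv_bounded_bilinear[THEN iffD1])
    (auto simp: bilinear_def vec_eq_iff matrix_matrix_mult_def sum.distrib algebra_simps
      scaleR_sum_right intro!: linearI)

lemmas tendsto_matrix_vector_mult = bounded_bilinear.tendsto[OF bounded_bilinear_matrix_vector_mult]
lemmas tendsto_matrix_matrix_mult = bounded_bilinear.tendsto[OF bounded_bilinear_matrix_matrix_mult]
lemmas continuous_on_matrix_matrix_mult =
  bounded_bilinear.continuous_on[OF bounded_bilinear_matrix_matrix_mult]

lemma matrix_eqI: "(\<And>x. A *v x = B *v x) \<Longrightarrow> A = (B :: complex^'n^'m)"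
  by (simp add: matrix_eq)

lemma scaleR_matrix_vector_mult: "(c *\<^sub>R A) *v x = c *\<^sub>R (A *v (x :: complex^'n))"
  by (rule bounded_bilinear.scaleR_left[OF bounded_bilinear_matrix_vector_mult])

lemma sum_matrix_vector_mult: "(\<Sum>i\<in>I. A i) *v x = (\<Sum>i\<in>I. A i *v (x :: complex^'n))"
  by (rule bounded_bilinear.sum_left[OF bounded_bilinear_matrix_vector_mult])

lemma scaleR_eq_vector_scalar_mult: "c *\<^sub>R x = complex_of_real c *s (x :: complex^'n)"
  by (simp add: vec_eq_iff scaleR_conv_of_real[where 'a=complex])

lemma mat_matrix_vector_mult: "mat c *v x = c *s (x :: complex^'n)"
  by (simp add: vec_eq_iff mat_def matrix_vector_mult_def if_distrib[of "\<lambda>x. x * _"] cong: if_cong)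

lemma norm_vec_le_sum: "norm (x :: 'a::real_normed_vector^'n) \<le> (\<Sum>i\<in>UNIV. norm (x $ i))"
  by (simp add: norm_vec_def L2_set_le_sum)

lemma invertible_iff_ker: 
  "invertible (A :: complex^'n^'n) \<longleftrightarrow> (\<forall>x. A *v x = 0 \<longrightarrow> x = 0)"
  by (simp add: invertible_left_inverse matrix_left_invertible_ker)

lemma matrix_inv_mult:
  assumes "invertible (A :: complex^'n^'n)"
  shows "A ** matrix_inv A = mat 1" "matrix_inv A ** A = mat 1"
  using someI_ex[OF assms[unfolded invertible_def]] by (auto simp: matrix_inv_def)

lemma matrix_inv_unique:
  fixes A B :: "complex^'n^'n"
  assumes "A ** B = mat 1" "B ** A = mat 1"
  shows "matrix_inv A = B"
proof -
  have "invertible A" using assms by (auto simp: invertible_def)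
  then have "B = (matrix_inv A ** A) ** B"
    by (simp add: matrix_inv_mult)
  also have "\<dots> = matrix_inv A"
    by (simp add: matrix_mul_assoc[symmetric] assms)
  finally show ?thesis ..
qed

section \<open>The sesquilinear form, adjoints and rank-one operators\<close>

lemma cinner_add_right: "cinner x (y + z) = cinner x y + cinner x z"
  by (simp add: cinner_def sum.distrib algebra_simps)

lemma cinner_diff_right: "cinner x (y - z) = cinner x y - cinner x z"
  by (simp add: cinner_def sum_subtractf algebra_simps)

lemma cinner_scale_right: "cinner x (c *s y) = c * cinner x y"
  by (simp add: cinner_def sum_distrib_left mult_ac)

lemma cinner_commute: "cinner x y = cnj (cinner y x)"
  by (simp add: cinner_def mult_ac)

lemma cinner_self: "cinner x x = (norm x)\<^sup>2"
proof -
  have "cinner x x = (\<Sum>i\<in>UNIV. of_real ((cmod (x $ i))\<^sup>2))"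
    unfolding cinner_def by (intro sum.cong refl) (simp add: complex_norm_square mult.commute del: of_real_power)
  also have "\<dots> = (norm x)\<^sup>2"
    by (simp add: norm_vec_def L2_set_def sum_nonneg  flip: of_real_power of_real_sum)
  finally show ?thesis .
qed

lemma cinner_eqI:
  assumes "\<And>z. cinner x z = cinner y z"
  shows "x = y"
proof -
  have "cinner x (axis i 1) = cnj (x $ i)" for x :: "complex^'n" and i
    by (simp add: cinner_def axis_def if_distrib[of "\<lambda>x. _ * x"] cong: if_cong)
  from this[of x] this[of y] show ?thesis
    using assms by (metis complex_cnj_cancel_iff vec_eq_iff)
qed

lemma bounded_linear_cinner_right: "bounded_linear (cinner (x :: complex^'n))"
  unfolding linear_conv_bounded_linear[symmetric]
  by (intro linearI cinner_add_right)
    (simp add: scaleR_eq_vector_scalar_mult cinner_scale_right scaleR_conv_of_real)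

text \<open>Taking adjoints is conjugate-linear, hence linear over the reals, which is the notion of
  linearity that Bochner integration uses.\<close>

lemma bounded_linear_adj: "bounded_linear (adj :: complex^'n^'n \<Rightarrow> _)"
  unfolding linear_conv_bounded_linear[symmetric]
  by (intro linearI) (auto simp: adj_def vec_eq_iff)

lemma adj_diff: "adj (A - B) = adj A - adj B"
  by (simp add: adj_def vec_eq_iff)

lemma adj_adj [simp]: "adj (adj A) = A"
  by (simp add: adj_def vec_eq_iff)

lemma adj_mult: "adj (A ** B) = adj B ** adj A"
  by (simp add: adj_def vec_eq_iff matrix_matrix_mult_def mult.commute)

lemma adj_mat_1 [simp]: "adj (mat 1) = mat 1"
  by (simp add: adj_def vec_eq_iff mat_def)

lemma invertible_adj: "invertible (adj A) \<longleftrightarrow> invertible (A :: complex^'n^'n)"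
proof -
  have "invertible (adj B)" if "invertible B" for B :: "complex^'n^'n"
    unfolding invertible_def using matrix_inv_mult[OF that]
    by (intro exI[of _ "adj (matrix_inv B)"]) (simp flip: adj_mult)
  from this[of A] this[of "adj A"] show ?thesis by auto
qed

lemma bounded_linear_ketbra_right: "bounded_linear (ketbra (x :: complex^'n))"
proof -
  have "ketbra x (y + z) = ketbra x y + ketbra x z" for y z
    by (simp add: ketbra_def matrix_def cinner_def vec_eq_iff algebra_simps sum.distrib)
  moreover have "ketbra x (c *\<^sub>R y) = c *\<^sub>R ketbra x y" for c y
    by (simp add: ketbra_def matrix_def cinner_def vec_eq_iff scaleR_sum_right sum_distrib_right)
  ultimately show ?thesis
    unfolding linear_conv_bounded_linear[symmetric] by (intro linearI)
qed

section \<open>Contractions and Cesaro means\<close>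

context
  fixes \<nu> :: "complex^'n \<Rightarrow> real"
  assumes \<nu>: "is_norm \<nu>"
begin

lemma is_norm_nonneg: "0 \<le> \<nu> x"
  and is_norm_eq_0: "\<nu> x = 0 \<longleftrightarrow> x = 0"
  and is_norm_scale: "\<nu> (c *s x) = cmod c * \<nu> x"
  and is_norm_add: "\<nu> (x + y) \<le> \<nu> x + \<nu> y"
  using \<nu> by (auto simp: is_norm_def)

lemma is_norm_scaleR: "\<nu> (c *\<^sub>R x) = \<bar>c\<bar> * \<nu> x"
  by (simp add: scaleR_eq_vector_scalar_mult is_norm_scale)

lemma is_norm_minus_commute: "\<nu> (x - y) = \<nu> (y - x)"
  using is_norm_scaleR[of "-1" "x - y"] by simp

lemma is_norm_diff_ge: "\<nu> x - \<nu> y \<le> \<nu> (x - y)"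
  using is_norm_add[of "x - y" y] by simp

lemma is_norm_sum: "\<nu> (\<Sum>i\<in>I. f i) \<le> (\<Sum>i\<in>I. \<nu> (f i))"
proof (induction I rule: infinite_finite_induct)
  case (insert i I)
  then show ?case using is_norm_add[of "f i" "\<Sum>i\<in>I. f i"] by simp
qed (simp_all add: is_norm_eq_0[THEN iffD2])

lemma is_norm_le_norm: "\<exists>K>0. \<forall>x. \<nu> x \<le> K * norm x"
proof -
  define K where "K = (\<Sum>i\<in>UNIV. \<nu> (axis i (1::complex)))"
  have "\<nu> x \<le> K * norm x" for x
  proof -
    have "x = (\<Sum>i\<in>UNIV. x $ i *s axis i 1)"
      by (simp add: vec_eq_iff axis_def if_distrib[of "\<lambda>y. _ * y"] cong: if_cong)
    then have "\<nu> x \<le> (\<Sum>i\<in>UNIV. \<nu> (x $ i *s axis i 1))"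
      by (metis is_norm_sum)
    also have "\<dots> \<le> (\<Sum>i\<in>UNIV. norm x * \<nu> (axis i 1))"
      by (intro sum_mono) (auto simp: is_norm_scale is_norm_nonneg Finite_Cartesian_Product.norm_nth_le intro!: mult_right_mono)
    finally show ?thesis by (simp add: K_def sum_distrib_left[symmetric] mult.commute)
  qed
  moreover have "K \<ge> 0" by (auto simp: K_def intro!: sum_nonneg is_norm_nonneg)
  ultimately show ?thesis
    by (intro exI[of _ "K + 1"]) (auto simp: algebra_simps add_increasing)
qed

lemma continuous_on_is_norm: "continuous_on S \<nu>"
proof -
  obtain K where K: "K > 0" "\<And>x. \<nu> x \<le> K * norm x" using is_norm_le_norm by blast
  have "\<bar>\<nu> x - \<nu> y\<bar> \<le> K * dist x y" for x y
    using is_norm_diff_ge[of x y] is_norm_diff_ge[of y x] is_norm_minus_commute[of x y] K(2)[of "x - y"]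
    by (simp add: dist_norm)
  then have "K-lipschitz_on S \<nu>"
    using K(1) by (intro lipschitz_onI) (auto simp: dist_real_def)
  then show ?thesis by (rule lipschitz_on_continuous_on)
qed

text \<open>By compactness \<open>\<nu>\<close> attains a minimum on the Euclidean unit sphere,
  positive by definiteness; homogeneity extends the bound to all vectors.\<close>

lemma norm_le_is_norm: "\<exists>K>0. \<forall>x. norm x \<le> K * \<nu> x"
proof -
  obtain u :: "complex^'n" where u: "u \<in> sphere 0 1" "\<And>x. x \<in> sphere 0 1 \<Longrightarrow> \<nu> u \<le> \<nu> x"
    using continuous_attains_inf[OF compact_sphere _ continuous_on_is_norm, of 0 1]
    by (metis sphere_eq_empty zero_less_one less_asym)
  have pos: "\<nu> u > 0"
    using u(1) is_norm_nonneg[of u] is_norm_eq_0[of u] by (auto simp: less_le)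
  have "norm x \<le> inverse (\<nu> u) * \<nu> x" for x :: "complex^'n"
  proof (cases "x = 0")
    case False
    have "\<nu> u \<le> \<nu> (inverse (norm x) *\<^sub>R x)" using False by (intro u(2)) simp
    then show ?thesis using pos False by (simp add: is_norm_scaleR field_simps)
  qed (simp add: is_norm_nonneg pos less_imp_le)
  then show ?thesis using pos by (intro exI[of _ "inverse (\<nu> u)"]) auto
qed

lemma contraction_mat_1: "contraction \<nu> (mat 1)"
  by (simp add: contraction_def)

lemma contraction_mult: "contraction \<nu> A \<Longrightarrow> contraction \<nu> B \<Longrightarrow> contraction \<nu> (A ** B)"
  by (simp add: contraction_def matrix_vector_mul_assoc[symmetric]) (meson order_trans)

text \<open>Convexity keeps Cesaro means among the contractions; together with closedness it does
  the same for expectations.\<close>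

lemma convex_contractions: "convex {A. contraction \<nu> A}"
proof (rule convexI)
  fix A B :: "complex^'n^'n" and u v :: real
  assume *: "A \<in> {A. contraction \<nu> A}" "B \<in> {A. contraction \<nu> A}" "0 \<le> u" "0 \<le> v" "u + v = 1"
  have "\<nu> ((u *\<^sub>R A + v *\<^sub>R B) *v x) \<le> \<nu> x" for x
  proof -
    have "\<nu> ((u *\<^sub>R A + v *\<^sub>R B) *v x) \<le> u * \<nu> (A *v x) + v * \<nu> (B *v x)"
      using is_norm_add[of "u *\<^sub>R (A *v x)" "v *\<^sub>R (B *v x)"] *(3,4)
      by (simp add: matrix_vector_mult_add_rdistrib scaleR_matrix_vector_mult is_norm_scaleR)
    also have "\<dots> \<le> u * \<nu> x + v * \<nu> x"
      using * by (intro add_mono mult_left_mono) (auto simp: contraction_def)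
    finally show ?thesis using *(5) by (simp flip: distrib_right)
  qed
  then show "u *\<^sub>R A + v *\<^sub>R B \<in> {A. contraction \<nu> A}" by (simp add: contraction_def)
qed

lemma closed_contractions: "closed {A. contraction \<nu> A}"
proof -
  have "closed {A. \<nu> (A *v x) \<le> \<nu> x}" for x :: "complex^'n"
    by (intro closed_Collect_le continuous_on_const continuous_on_compose2[OF continuous_on_is_norm]
        bounded_bilinear.continuous_on[OF bounded_bilinear_matrix_vector_mult] continuous_on_id) auto
  then have "closed (\<Inter>x. {A. \<nu> (A *v x) \<le> \<nu> x})" by blast
  then show ?thesis by (simp add: contraction_def INT_iff Collect_all_eq)
qed

text \<open>A single Euclidean bound for all contractions gives compactness here, and integrability
  and bounded increments later.\<close>

lemma norm_contraction_le: "\<exists>K>0. \<forall>A. contraction \<nu> A \<longrightarrow> norm A \<le> K"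
proof -
  obtain K1 where K1: "K1 > 0" "\<And>x. \<nu> x \<le> K1 * norm x" using is_norm_le_norm by blast
  obtain K2 where K2: "K2 > 0" "\<And>x. norm x \<le> K2 * \<nu> x" using norm_le_is_norm by blast
  have "norm A \<le> real CARD('n) * (real CARD('n) * (K2 * K1))" if "contraction \<nu> A" for A
  proof -
    have "norm (A $ i $ j) \<le> K2 * K1" for i j
    proof -
      have "A $ i $ j = (A *v axis j 1) $ i"
        by (simp add: matrix_vector_mult_def axis_def if_distrib[of "\<lambda>y. _ * y"] cong: if_cong)
      then have "norm (A $ i $ j) \<le> norm (A *v axis j 1)" by (metis Finite_Cartesian_Product.norm_nth_le)
      also have "\<dots> \<le> K2 * \<nu> (A *v axis j 1)" by (rule K2)
      also have "\<dots> \<le> K2 * \<nu> (axis j 1)" using that K2(1) by (simp add: contraction_def)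
      also have "\<dots> \<le> K2 * (K1 * norm (axis j (1::complex)))" using K1(2)[of "axis j 1"] K2(1) by (intro mult_left_mono) auto
      finally show ?thesis by simp
    qed
    then have "norm (A $ i) \<le> real CARD('n) * (K2 * K1)" for i
      using sum_bounded_above[of UNIV "\<lambda>j. norm (A $ i $ j)"] norm_vec_le_sum[of "A $ i"]
      by (metis order_trans)
    then show ?thesis
      using sum_bounded_above[of UNIV "\<lambda>i. norm (A $ i)"] norm_vec_le_sum[of A]
      by (metis order_trans)
  qed
  moreover have "real CARD('n) * (real CARD('n) * (K2 * K1)) > 0" using K1 K2 by simp
  ultimately show ?thesis by blast
qed

lemma compact_contractions: "compact {A. contraction \<nu> A}"
  using norm_contraction_le closed_contractions by (auto simp: compact_eq_bounded_closed bounded_iff)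

end

section \<open>Powers and Cesaro means of a single matrix\<close>

primrec mat_pow :: "complex^'n^'n \<Rightarrow> nat \<Rightarrow> complex^'n^'n" where
  "mat_pow A 0 = mat 1"
| "mat_pow A (Suc n) = mat_pow A n ** A"

definition cesaro :: "complex^'n^'n \<Rightarrow> nat \<Rightarrow> complex^'n^'n" where
  "cesaro A N = (1 / real N) *\<^sub>R (\<Sum>n=1..N. mat_pow A n)"

lemma mat_pow_Suc: "mat_pow A (Suc n) = A ** mat_pow A n"
  by (induction n) (simp_all, metis matrix_mul_assoc)

lemma mat_pow_eigenvector: "A *v x = x \<Longrightarrow> mat_pow A n *v x = x"
  by (induction n) (simp_all add: matrix_vector_mul_assoc[symmetric])

lemma contraction_mat_pow: "is_norm \<nu> \<Longrightarrow> contraction \<nu> A \<Longrightarrow> contraction \<nu> (mat_pow A n)"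
  by (induction n) (auto intro: contraction_mat_1 contraction_mult)

lemma cesaro_eigenvector: "A *v x = x \<Longrightarrow> 0 < N \<Longrightarrow> cesaro A N *v x = x"
  by (simp add: cesaro_def scaleR_matrix_vector_mult sum_matrix_vector_mult mat_pow_eigenvector
      sum_constant_scaleR del: sum_constant)

lemma continuous_on_cesaro: "continuous_on S (\<lambda>A. cesaro A N)"
proof -
  have "continuous_on S (\<lambda>A. mat_pow A n)" for n
    by (induction n) (auto intro!: continuous_on_matrix_matrix_mult continuous_on_id)
  then show ?thesis unfolding cesaro_def by (intro continuous_intros)
qed

lemma contraction_cesaro:
  assumes "is_norm \<nu>" "contraction \<nu> A" "0 < N"
  shows "contraction \<nu> (cesaro A N)"
proof -
  have "(\<Sum>n=1..N. (1 / real N) *\<^sub>R mat_pow A n) \<in> {A. contraction \<nu> A}"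
    using assms by (intro convex_sum convex_contractions) (auto simp: contraction_mat_pow)
  then show ?thesis by (simp add: cesaro_def scaleR_sum_right)
qed

text \<open>Multiplication by \<open>A\<close> moves the summation window by one index, so only the
  two end powers survive in the difference.\<close>

lemma cesaro_shift:
  "cesaro A N ** A = cesaro A N + (1 / real N) *\<^sub>R (mat_pow A (Suc N) - A)"
  "A ** cesaro A N = cesaro A N + (1 / real N) *\<^sub>R (mat_pow A (Suc N) - A)"
proof -
  have tele: "(\<Sum>n=1..N. mat_pow A (Suc n)) = (\<Sum>n=1..N. mat_pow A n) + (mat_pow A (Suc N) - A)"
    by (induction N) (simp_all add: algebra_simps)
  have "cesaro A N ** A = (1 / real N) *\<^sub>R (\<Sum>n=1..N. mat_pow A (Suc n))"
    by (simp add: cesaro_def bounded_bilinear.scaleR_left[OF bounded_bilinear_matrix_matrix_mult]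
        bounded_bilinear.sum_left[OF bounded_bilinear_matrix_matrix_mult])
  moreover have "A ** cesaro A N = (1 / real N) *\<^sub>R (\<Sum>n=1..N. mat_pow A (Suc n))"
    by (simp add: cesaro_def bounded_bilinear.scaleR_right[OF bounded_bilinear_matrix_matrix_mult]
        bounded_bilinear.sum_right[OF bounded_bilinear_matrix_matrix_mult] mat_pow_Suc
        del: mat_pow.simps)
  ultimately show "cesaro A N ** A = cesaro A N + (1 / real N) *\<^sub>R (mat_pow A (Suc N) - A)"
    "A ** cesaro A N = cesaro A N + (1 / real N) *\<^sub>R (mat_pow A (Suc N) - A)"
    by (simp_all only: tele cesaro_def scaleR_add_right)
qed

lemma tendsto_scaleR_over_n:
  assumes "\<And>N. norm (f N) \<le> (K::real)"
  shows "(\<lambda>N. (1 / real N) *\<^sub>R f N) \<longlonglongrightarrow> 0"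
proof (rule Lim_null_comparison)
  show "(\<lambda>N. K / real N) \<longlonglongrightarrow> 0" by (rule lim_const_over_n)
  show "\<forall>\<^sub>F N in sequentially. norm ((1 / real N) *\<^sub>R f N) \<le> K / real N"
    using assms by (auto intro!: always_eventually divide_right_mono)
qed

text \<open>
  Any two limit points of the Cesaro means absorb each other, since both commute with the means
  and fix what \<open>A\<close> fixes; hence they coincide.
\<close>

lemma cesaro_converges:
  assumes \<nu>: "is_norm \<nu>" and A: "contraction \<nu> A"
  obtains P where "cesaro A \<longlonglongrightarrow> P" "A ** P = P" "P ** A = P" "\<And>x. A *v x = x \<Longrightarrow> P *v x = x"
proof -
  obtain K where K: "\<And>A. contraction \<nu> A \<Longrightarrow> norm A \<le> K"
    using norm_contraction_le[OF \<nu>] by blast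
  have shift0: "(\<lambda>N. (1 / real N) *\<^sub>R (mat_pow A (Suc N) - A)) \<longlonglongrightarrow> 0"
    using K[OF contraction_mat_pow[OF \<nu> A]] K[OF A]
    by (intro tendsto_scaleR_over_n[of _ "K + K"]) (metis norm_triangle_le_diff add_mono)
  have limit_point: "A ** P = P" "P ** A = P" "A *v x = x \<Longrightarrow> P *v x = x"
    "Q ** A = Q \<Longrightarrow> Q ** P = Q"
    if r: "strict_mono r" "(cesaro A \<circ> r) \<longlonglongrightarrow> P" for r P Q x
  proof -
    have shift: "(\<lambda>k. (1 / real (r k)) *\<^sub>R (mat_pow A (Suc (r k)) - A)) \<longlonglongrightarrow> 0"
      using LIMSEQ_subseq_LIMSEQ[OF shift0 r(1)] by (simp add: o_def)
    have ev: "\<forall>\<^sub>F k in sequentially. 0 < r k"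
      using eventually_gt_at_top[of 0] by eventually_elim (metis r(1) seq_suble less_le_trans)
    have "(\<lambda>k. cesaro A (r k) + (1 / real (r k)) *\<^sub>R (mat_pow A (Suc (r k)) - A)) \<longlonglongrightarrow> P + 0"
      using r(2) by (intro tendsto_add shift) (simp add: o_def)
    then have *: "(\<lambda>k. A ** cesaro A (r k)) \<longlonglongrightarrow> P" "(\<lambda>k. cesaro A (r k) ** A) \<longlonglongrightarrow> P"
      by (simp_all only: cesaro_shift add_0_right)
    show "A ** P = P"
      using r(2) by (intro LIMSEQ_unique[OF tendsto_matrix_matrix_mult[OF tendsto_const] *(1)]) (simp add: o_def)
    show "P ** A = P"
      using r(2) by (intro LIMSEQ_unique[OF tendsto_matrix_matrix_mult[OF _ tendsto_const] *(2)]) (simp add: o_def)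
    show "P *v x = x" if "A *v x = x"
    proof (rule LIMSEQ_unique)
      show "(\<lambda>k. cesaro A (r k) *v x) \<longlonglongrightarrow> P *v x"
        using r(2) by (intro tendsto_matrix_vector_mult) (auto simp: o_def)
      show "(\<lambda>k. cesaro A (r k) *v x) \<longlonglongrightarrow> x"
        by (intro tendsto_eventually eventually_mono[OF ev]) (simp add: cesaro_eigenvector[OF that])
    qed
    show "Q ** P = Q" if "Q ** A = Q"
    proof (rule LIMSEQ_unique)
      have "Q ** mat_pow A n = Q" for n
        by (induction n) (simp_all add: matrix_mul_assoc that)
      then have "Q ** cesaro A N = Q" if "0 < N" for N
        using that by (simp add: cesaro_def sum_constant_scaleR
            bounded_bilinear.scaleR_right[OF bounded_bilinear_matrix_matrix_mult]
            bounded_bilinear.sum_right[OF bounded_bilinear_matrix_matrix_mult] del: sum_constant)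
      then show "(\<lambda>k. Q ** cesaro A (r k)) \<longlonglongrightarrow> Q"
        by (intro tendsto_eventually eventually_mono[OF ev])
      show "(\<lambda>k. Q ** cesaro A (r k)) \<longlonglongrightarrow> Q ** P"
        using r(2) by (intro tendsto_matrix_matrix_mult) (auto simp: o_def)
    qed
  qed
  have unique: "P = P'"
    if "strict_mono r" "(cesaro A \<circ> r) \<longlonglongrightarrow> P" "strict_mono r'" "(cesaro A \<circ> r') \<longlonglongrightarrow> P'" for r r' P P'
  proof -
    have "P ** P' = P" using limit_point(2)[OF that(1,2)] limit_point(4)[OF that(3,4)] by blast
    moreover have "P ** P' = P'"
      by (intro matrix_eqI)
        (metis limit_point(1)[OF that(3,4)] limit_point(3)[OF that(1,2)] matrix_vector_mul_assoc)
    ultimately show ?thesis by simp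
  qed
  have compact: "compact {A. contraction \<nu> A}" by (rule compact_contractions[OF \<nu>])
  have subseq: "\<exists>P r. strict_mono r \<and> (cesaro A \<circ> (s \<circ> r)) \<longlonglongrightarrow> P" if "strict_mono s" for s :: "nat \<Rightarrow> nat"
  proof -
    \<comment> \<open>Passing to \<open>s (Suc k)\<close> avoids the index 0, as
      \<open>contraction_cesaro\<close> asks for a positive length.\<close>
    have "\<forall>k. cesaro A (s (Suc k)) \<in> {A. contraction \<nu> A}"
      using that by (auto intro!: contraction_cesaro[OF \<nu> A] simp: strict_mono_Suc_iff)
        (metis less_nat_zero_code not_gr_zero strict_mono_Suc_iff that)
    then obtain P r where r: "strict_mono r" "((\<lambda>k. cesaro A (s (Suc k))) \<circ> r) \<longlonglongrightarrow> P"
      using compact[unfolded compact_def] by meson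
    then show ?thesis
      by (intro exI[of _ P] exI[of _ "Suc \<circ> r"]) (auto simp: o_def strict_mono_def)
  qed
  obtain P r where r: "strict_mono r" "(cesaro A \<circ> r) \<longlonglongrightarrow> P"
    using subseq[of id] by (auto simp: strict_mono_id)
  have "cesaro A \<longlonglongrightarrow> P"
  proof (rule ccontr)
    \<comment> \<open>Otherwise a subsequence keeps distance \<open>e\<close> from \<open>P\<close>,
      yet by compactness it has a further subsequence with a limit, which must be
      \<open>P\<close>.\<close>
    assume "\<not> cesaro A \<longlonglongrightarrow> P"
    then obtain e where e: "e > 0" "\<exists>\<^sub>F N in sequentially. \<not> dist (cesaro A N) P < e"
      by (auto simp: tendsto_iff frequently_def)
    then have "infinite {N. \<not> dist (cesaro A N) P < e}"
      by (simp add: frequently_cofinite[symmetric] cofinite_eq_sequentially)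
    then obtain s :: "nat \<Rightarrow> nat" where s: "strict_mono s" "\<And>k. \<not> dist (cesaro A (s k)) P < e"
      using infinite_enumerate[of "{N. \<not> dist (cesaro A N) P < e}"] by blast
    obtain P' r' where r': "strict_mono r'" "(cesaro A \<circ> (s \<circ> r')) \<longlonglongrightarrow> P'"
      using subseq[OF s(1)] by blast
    have "P' = P" using unique[OF strict_mono_o[OF s(1) r'(1)] r'(2) r] .
    then have "\<forall>\<^sub>F k in sequentially. dist (cesaro A (s (r' k))) P < e"
      using tendstoD[OF r'(2) e(1)] by (simp add: o_def)
    then show False using s(2) by simp
  qed
  then show ?thesis using that limit_point(1-3)[OF r] by blast
qed

section \<open>The Riesz projection of a contraction\<close>

lemma holomorphic_on_mat: "(\<lambda>z. (mat z :: complex^'n^'n) $ i $ j) holomorphic_on S"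
  by (cases "i = j") (simp_all add: mat_def)

lemma holomorphic_on_det:
  assumes "\<And>i j. (\<lambda>z. F z $ i $ j) holomorphic_on S"
  shows "(\<lambda>z. det (F z :: complex^'n^'n)) holomorphic_on S"
  unfolding det_def by (intro holomorphic_intros assms)

text \<open>By Cramer's rule each entry of the inverse is a quotient of determinants, which are
  polynomials in the entries. \<open>?C z\<close> is \<open>F z\<close> with column \<open>i\<close>
  replaced by the \<open>j\<close>-th unit vector.\<close>

lemma holomorphic_on_matrix_inv:
  fixes F :: "complex \<Rightarrow> complex^'n^'n"
  assumes F: "\<And>i j. (\<lambda>z. F z $ i $ j) holomorphic_on S" and inv: "\<And>z. z \<in> S \<Longrightarrow> invertible (F z)"
  shows "(\<lambda>z. matrix_inv (F z) $ i $ j) holomorphic_on S"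
proof -
  let ?C = "\<lambda>z. \<chi> k l. if l = i then axis j 1 $ k else F z $ k $ l"
  have "matrix_inv (F z) $ i $ j = det (?C z) / det (F z)" if "z \<in> S" for z
  proof -
    have "F z *v (matrix_inv (F z) *v axis j 1) = axis j 1"
      using matrix_inv_mult(1)[OF inv[OF that]] by (simp add: matrix_vector_mul_assoc)
    then have "matrix_inv (F z) *v axis j 1 =
        (\<chi> k. det (\<chi> i l. if l = k then axis j 1 $ i else F z $ i $ l) / det (F z))"
      using cramer[of "F z"] inv[OF that] by (simp add: invertible_det_nz)
    moreover have "(matrix_inv (F z) *v axis j 1) $ i = matrix_inv (F z) $ i $ j"
      by (simp add: matrix_vector_mult_def axis_def if_distrib[of "\<lambda>y. _ * y"] cong: if_cong)
    ultimately show ?thesis by simp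
  qed
  moreover have "(\<lambda>z. det (?C z) / det (F z)) holomorphic_on S"
  proof (intro holomorphic_on_divide holomorphic_on_det F)
    show "(\<lambda>z. ?C z $ k $ l) holomorphic_on S" for k l
      by (cases "l = i") (simp_all add: F)
  qed (use inv in \<open>auto simp: invertible_det_nz\<close>)
  ultimately show ?thesis by (simp cong: holomorphic_cong)
qed

text \<open>
  Adding a multiple of the spectral projection \<open>P\<close> moves the eigenvalue 1 to \<open>1 + c\<close> and leaves
  the others in place; so on a disc around 1 the resolvent of \<open>A\<close> is \<open>P / (z - 1)\<close> plus a
  holomorphic part expressed by the resolvent of \<open>A + c P\<close>.
\<close>

locale absorbing_projection =
  fixes A P :: "complex^'n^'n"
  assumes A_P: "A ** P = P" and P_A: "P ** A = P" and fixed: "\<And>x. A *v x = x \<Longrightarrow> P *v x = x"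
begin

lemma A_P_vec [simp]: "A *v (P *v x) = P *v x"
  by (simp add: matrix_vector_mul_assoc A_P)

lemma P_A_vec [simp]: "P *v (A *v x) = P *v x"
  by (simp add: matrix_vector_mul_assoc P_A)

lemma P_P_vec [simp]: "P *v (P *v x) = P *v x"
  by (simp add: fixed)

definition shifted :: "complex \<Rightarrow> complex^'n^'n" where
  "shifted c = A + mat c ** P"

lemma shifted_vec: "shifted c *v x = A *v x + c *s (P *v x)"
  by (simp add: shifted_def matrix_vector_mult_add_rdistrib mat_matrix_vector_mult flip: matrix_vector_mul_assoc)

lemma P_shifted: "P *v (shifted c *v x) = (1 + c) *s (P *v x)"
  by (simp add: shifted_vec matrix_vector_right_distrib vector_scalar_commute vector_sadd_rdistrib)

text \<open>Applying \<open>P\<close> to a kernel vector \<open>x\<close> gives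
  \<open>(z - 1 - c) P x = 0\<close>, so \<open>P x = 0\<close> and \<open>A x = z x\<close>. For
  \<open>z = 1\<close> this \<open>x\<close> is fixed by \<open>A\<close>, whence
  \<open>x = P x = 0\<close>; so the second hypothesis can exempt \<open>z = 1\<close>.\<close>

lemma invertible_resolvent_shifted:
  assumes "z \<noteq> 1 + c" and "\<And>x. A *v x = z *s x \<Longrightarrow> z \<noteq> 1 \<Longrightarrow> x = 0"
  shows "invertible (mat z - shifted c)"
  unfolding invertible_iff_ker
proof (intro allI impI)
  fix x assume "(mat z - shifted c) *v x = 0"
  then have *: "z *s x = shifted c *v x"
    by (simp add: matrix_vector_mult_diff_rdistrib mat_matrix_vector_mult)
  then have "z *s (P *v x) = (1 + c) *s (P *v x)"
    by (metis P_shifted vector_scalar_commute)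
  then have "P *v x = 0" using assms(1) vec.scale_cancel_right by blast
  with * assms(2) fixed show "x = 0" by (cases "z = 1") (auto simp: shifted_vec)
qed

text \<open>\<open>A\<close> acts as the identity on the range of \<open>P\<close> and agrees with
  \<open>shifted c\<close> on its kernel. This suggests the candidate
  \<open>P / (z - 1) + (1 - P) R\<close>; for square matrices it is enough to check that it is a
  right inverse.\<close>

lemma resolvent_decomposition:
  assumes "z \<noteq> 1" and inv: "invertible (mat z - shifted c)"
  defines "R \<equiv> matrix_inv (mat z - shifted c)"
  shows "matrix_inv (mat z - A) $ i $ j = P $ i $ j / (z - 1) + (R - P ** R) $ i $ j"
proof -
  define S where "S = mat (1 / (z - 1)) ** P + (R - P ** R)"
  have "(mat z - A) ** S = mat 1"
  proof (rule matrix_eqI)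
    fix x
    define y where "y = R *v x"
    have "(mat z - shifted c) *v y = x"
      using matrix_inv_mult(1)[OF inv] by (simp add: y_def R_def matrix_vector_mul_assoc)
    then have y: "z *s y = x + A *v y + c *s (P *v y)"
      by (simp add: matrix_vector_mult_diff_rdistrib mat_matrix_vector_mult shifted_vec algebra_simps)
    then have Py: "z *s (P *v y) = P *v x + P *v y + c *s (P *v y)"
      by (metis P_A_vec P_P_vec matrix_vector_right_distrib vector_scalar_commute)
    have Sx: "S *v x = (1 / (z - 1)) *s (P *v x) + (y - P *v y)"
      by (simp add: S_def y_def matrix_vector_mult_add_rdistrib matrix_vector_mult_diff_rdistrib
          mat_matrix_vector_mult flip: matrix_vector_mul_assoc)
    have "(mat z - A) *v (S *v x) =
        (z / (z - 1)) *s (P *v x) - (1 / (z - 1)) *s (P *v x) + (z *s y - A *v y)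
          - (z *s (P *v y) - P *v y)"
      unfolding Sx
      by (simp add: matrix_vector_mult_diff_rdistrib mat_matrix_vector_mult matrix_vector_right_distrib
          matrix_vector_mult_diff_distrib vector_scalar_commute algebra_simps vector_add_ldistrib
          vector_ssub_ldistrib)
    also have "(z / (z - 1)) *s (P *v x) - (1 / (z - 1)) *s (P *v x) = P *v x"
      using assms(1) by (simp add: vec_eq_iff divide_simps) (simp add: algebra_simps)
    finally show "((mat z - A) ** S) *v x = mat 1 *v x"
      by (simp add: y Py flip: matrix_vector_mul_assoc)
  qed
  then have "matrix_inv (mat z - A) = S"
    by (intro matrix_inv_unique) (auto simp: matrix_left_right_inverse)
  moreover have "(mat (1 / (z - 1)) ** P) $ i $ j = P $ i $ j / (z - 1)"
    by (simp add: matrix_matrix_mult_def mat_def if_distrib[of "\<lambda>x. x * _"] cong: if_cong)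
  ultimately show ?thesis by (simp add: S_def)
qed

text \<open>This makes the choice of a radius in \<open>riesz_projection\<close> meaningful. An
  eigenvector for \<open>z\<close> other than 1 is killed by \<open>P\<close>, hence lies in the
  kernel of \<open>mat z - shifted 1\<close>, whose determinant is nonzero near 1.\<close>

lemma eigenvalues_isolated: "\<exists>r>0. \<forall>z. is_eigenvalue A z \<and> z \<noteq> 1 \<longrightarrow> r < dist 1 z"
proof -
  have "invertible (mat 1 - shifted 1)" by (rule invertible_resolvent_shifted) auto
  moreover have "isCont (\<lambda>z. det (mat z - shifted 1)) 1"
  proof -
    have "(\<lambda>z. det (mat z - shifted 1)) holomorphic_on UNIV"
      by (intro holomorphic_on_det) (auto intro!: holomorphic_intros holomorphic_on_mat)
    then show ?thesis
      using holomorphic_on_imp_continuous_on continuous_on_eq_continuous_at[OF open_UNIV] by blast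
  qed
  ultimately obtain r where r: "r > 0" "\<And>z. dist z 1 < r \<Longrightarrow> det (mat z - shifted 1) \<noteq> 0"
    using continuous_at_avoid[of 1 "\<lambda>z. det (mat z - shifted 1)" 0]
    by (auto simp: invertible_det_nz dist_commute)
  have "r / 2 < dist 1 z" if z: "is_eigenvalue A z" "z \<noteq> 1" for z
  proof (rule ccontr)
    assume "\<not> ?thesis"
    then have "invertible (mat z - shifted 1)"
      using r by (simp add: invertible_det_nz dist_commute)
    moreover obtain v where v: "v \<noteq> 0" "A *v v = z *s v"
      using z(1) by (auto simp: is_eigenvalue_def)
    have "P *v v = z *s (P *v v)" by (metis P_A_vec v(2) vector_scalar_commute)
    then have "P *v v = 0" using z(2) by (auto simp: vec_eq_iff)
    then have "(mat z - shifted 1) *v v = 0"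
      by (simp add: matrix_vector_mult_diff_rdistrib mat_matrix_vector_mult shifted_vec v)
    ultimately show False using v(1) by (simp add: invertible_iff_ker)
  qed
  then show ?thesis using r(1) by (intro exI[of _ "r / 2"]) auto
qed

text \<open>On the circle the integrand is \<open>f z / (z - 1)\<close> with \<open>f\<close>
  holomorphic on the disc and \<open>f 1\<close> the entry of \<open>P\<close>, so Cauchy's integral
  formula applies.\<close>

lemma riesz_projection_eq: "riesz_projection A 1 = P"
proof -
  define r where "r = (SOME r. 0 < r \<and> (\<forall>z. is_eigenvalue A z \<and> z \<noteq> 1 \<longrightarrow> r < dist 1 z))"
  have r: "0 < r" "\<And>z. is_eigenvalue A z \<Longrightarrow> z \<noteq> 1 \<Longrightarrow> r < dist 1 z"
    using someI_ex[OF eigenvalues_isolated] unfolding r_def by auto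
  \<comment> \<open>This \<open>c\<close> moves the eigenvalue 1 to distance \<open>r + 1\<close>
    from 1, outside the closed disc of radius \<open>r\<close>.\<close>
  define c where "c = complex_of_real (r + 1)"
  define R where "R z = matrix_inv (mat z - shifted c)" for z
  have inv: "invertible (mat z - shifted c)" if "z \<in> cball 1 r" for z
  proof (rule invertible_resolvent_shifted)
    have "dist 1 (1 + c) = r + 1" using r(1) by (simp add: c_def dist_norm del: of_real_add)
    then show "z \<noteq> 1 + c" using that by auto
    show "x = 0" if "A *v x = z *s x" "z \<noteq> 1" for x
      using r(2)[of z] that \<open>z \<in> cball 1 r\<close> by (force simp: is_eigenvalue_def)
  qed
  have "contour_integral (circlepath 1 r) (\<lambda>z. matrix_inv (mat z - A) $ i $ j)
      = 2 * of_real pi * \<i> * P $ i $ j" for i j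
  proof (rule contour_integral_unique)
    define f where "f z = P $ i $ j + (z - 1) * (R z - P ** R z) $ i $ j" for z
    have R: "(\<lambda>z. R z $ k $ l) holomorphic_on cball 1 r" for k l
      unfolding R_def by (rule holomorphic_on_matrix_inv[OF _ inv])
        (auto intro!: holomorphic_intros holomorphic_on_mat)
    then have "f holomorphic_on cball 1 r"
      unfolding f_def by (auto simp: matrix_matrix_mult_def intro!: holomorphic_intros)
    then have "((\<lambda>z. f z / (z - 1)) has_contour_integral 2 * of_real pi * \<i> * f 1) (circlepath 1 r)"
      using r(1) by (intro Cauchy_integral_circlepath_simple) auto
    moreover have "f z / (z - 1) = matrix_inv (mat z - A) $ i $ j"
      if "z \<in> path_image (circlepath 1 r)" for z
    proof -
      have z: "z \<noteq> 1" "z \<in> cball 1 r" using that r(1) by auto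
      show ?thesis
        unfolding resolvent_decomposition[OF z(1) inv[OF z(2)]] f_def R_def
        using z(1) by (simp add: field_simps)
    qed
    ultimately show "((\<lambda>z. matrix_inv (mat z - A) $ i $ j) has_contour_integral
        2 * of_real pi * \<i> * P $ i $ j) (circlepath 1 r)"
      by (auto simp: f_def intro: has_contour_integral_eq)
  qed
  then show ?thesis
    by (simp add: riesz_projection_def r_def[symmetric] Let_def vec_eq_iff)
qed

end

text \<open>The mean ergodic theorem in finite dimension. It applies both to every
  \<open>M \<omega>\<close> and to the expectation.\<close>

lemma
  assumes "is_norm \<nu>" "contraction \<nu> A"
  shows cesaro_tendsto_riesz: "cesaro A \<longlonglongrightarrow> riesz_projection A 1"
    and absorbing_projection_riesz: "absorbing_projection A (riesz_projection A 1)"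
proof -
  obtain P where P: "cesaro A \<longlonglongrightarrow> P" "A ** P = P" "P ** A = P" "\<And>x. A *v x = x \<Longrightarrow> P *v x = x"
    using cesaro_converges[OF assms] by blast
  then have "absorbing_projection A P" by unfold_locales
  with absorbing_projection.riesz_projection_eq[OF this] P(1)
  show "cesaro A \<longlonglongrightarrow> riesz_projection A 1" "absorbing_projection A (riesz_projection A 1)"
    by simp_all
qed

section \<open>Averages of contractions\<close>

text \<open>A point outside \<open>C\<close> is strictly separated from \<open>C\<close> by a
  hyperplane; integrating the separating inequality over \<open>U\<close> contradicts this for the
  average.\<close>

lemma (in finite_measure) average_in_closed_convex:
  fixes f :: "'a \<Rightarrow> 'b::euclidean_space"
  assumes C: "closed C" "convex C"
    and U: "U \<in> sets M" "measure M U > 0"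
    and f: "integrable M f" "\<And>x. x \<in> U \<Longrightarrow> f x \<in> C"
  shows "(1 / measure M U) *\<^sub>R (\<integral>x. indicator U x *\<^sub>R f x \<partial>M) \<in> C" (is "?y \<in> C")
proof (rule ccontr)
  assume "?y \<notin> C"
  then obtain a b where ab: "a \<bullet> ?y < b" "\<And>x. x \<in> C \<Longrightarrow> b < a \<bullet> x"
    using separating_hyperplane_closed_point[OF C(2,1)] by blast
  have int: "integrable M (\<lambda>x. indicator U x *\<^sub>R f x)"
    using f(1) U(1) by (intro integrable_mult_indicator)
  have "b * measure M U = (\<integral>x. indicator U x * b \<partial>M)"
    using U by (simp add: mult.commute)
  also have "\<dots> \<le> (\<integral>x. a \<bullet> (indicator U x *\<^sub>R f x) \<partial>M)"
  proof (rule integral_mono)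
    show "integrable M (\<lambda>x. indicator U x * b)"
      using U(1) by (intro integrable_mult_left integrable_real_indicator) (auto simp: less_top[symmetric])
    show "integrable M (\<lambda>x. a \<bullet> (indicator U x *\<^sub>R f x))"
      using int by (rule integrable_inner_right)
    show "indicator U x * b \<le> a \<bullet> (indicator U x *\<^sub>R f x)" for x
      using ab(2)[OF f(2), of x] by (auto simp: indicator_def less_imp_le)
  qed
  also have "\<dots> = measure M U * (a \<bullet> ?y)"
    using U(2) by (subst integral_inner_right[OF int]) simp
  finally show False using ab(1) U(2) by (simp add: field_simps)
qed

lemma (in prob_space) expectation_in_closed_convex:
  fixes f :: "'a \<Rightarrow> 'b::euclidean_space"
  assumes "closed C" "convex C" "integrable M f" "\<And>x. x \<in> space M \<Longrightarrow> f x \<in> C"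
  shows "(\<integral>x. f x \<partial>M) \<in> C"
proof -
  have "(\<integral>x. indicator (space M) x *\<^sub>R f x \<partial>M) = (\<integral>x. f x \<partial>M)"
    by (intro Bochner_Integration.integral_cong) auto
  then show ?thesis
    using average_in_closed_convex[of C "space M" f] assms by (simp add: prob_space)
qed

text \<open>If every point of \<open>S\<close> had a ball with null preimage, countably many of
  these balls would cover \<open>S\<close> by Lindelof, and the preimage of \<open>S\<close> would
  be null.\<close>

lemma (in finite_measure) exists_support_point:
  fixes f :: "'a \<Rightarrow> 'b::{metric_space, second_countable_topology}"
  assumes f [measurable]: "f \<in> borel_measurable M" and pos: "measure M {x \<in> space M. f x \<in> S} > 0"
  shows "\<exists>y\<in>S. \<forall>e>0. measure M {x \<in> space M. dist y (f x) < e} > 0"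
proof (rule ccontr)
  assume "\<not> ?thesis"
  then have "\<forall>y\<in>S. \<exists>e. 0 < e \<and> measure M {x \<in> space M. dist y (f x) < e} \<le> 0"
    by (auto simp: not_less)
  from bchoice[OF this] obtain e where e: "\<And>y. y \<in> S \<Longrightarrow> e y > 0"
      "\<And>y. y \<in> S \<Longrightarrow> measure M {x \<in> space M. dist y (f x) < e y} \<le> 0"
    by blast
  obtain \<F> where \<F>: "\<F> \<subseteq> (\<lambda>y. ball y (e y)) ` S" "countable \<F>" "\<Union>\<F> = (\<Union>y\<in>S. ball y (e y))"
    by (rule Lindelof[of "(\<lambda>y. ball y (e y)) ` S"]) auto
  obtain T where T: "countable T" "T \<subseteq> S" "\<F> = (\<lambda>y. ball y (e y)) ` T"
    using countable_subset_image[of \<F> "\<lambda>y. ball y (e y)" S] \<F>(1,2) by blast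
  have null: "{x \<in> space M. dist y (f x) < e y} \<in> null_sets M" if "y \<in> T" for y
  proof (rule null_setsI)
    show "emeasure M {x \<in> space M. dist y (f x) < e y} = 0"
      using e(2)[of y] that T(2) by (auto simp: emeasure_eq_measure measure_le_0_iff)
  qed measurable
  have null_union: "(\<Union>y\<in>T. {x \<in> space M. dist y (f x) < e y}) \<in> null_sets M"
    using T(1) null by (intro null_sets_UN') auto
  then have "(\<Union>y\<in>T. {x \<in> space M. dist y (f x) < e y}) \<in> sets M" by auto
  moreover have "{x \<in> space M. f x \<in> S} \<subseteq> (\<Union>y\<in>T. {x \<in> space M. dist y (f x) < e y})"
  proof
    fix x assume x: "x \<in> {x \<in> space M. f x \<in> S}"
    then have "f x \<in> \<Union>\<F>" using e(1) unfolding \<F>(3) by (auto intro!: bexI[of _ "f x"])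
    then show "x \<in> (\<Union>y\<in>T. {x \<in> space M. dist y (f x) < e y})"
      using x T(3) by auto
  qed
  \<comment> \<open>Monotonicity asks for measurability of the larger set alone, so \<open>S\<close>
    may be arbitrary.\<close>
  ultimately have "measure M {x \<in> space M. f x \<in> S}
      \<le> measure M (\<Union>y\<in>T. {x \<in> space M. dist y (f x) < e y})"
    by (intro finite_measure_mono) auto
  also have "\<dots> = 0" using null_union by (rule measure_eq_0_null_sets)
  finally show False using pos by simp
qed

text \<open>Expanding the \<open>n\<close>-th power of \<open>A\<close>, the word made of
  \<open>B\<close> alone has weight \<open>q ^ n\<close>; the other words are contractions of total
  weight \<open>1 - q ^ n\<close>.\<close>

lemma mat_pow_convex_combination:
  assumes \<nu>: "is_norm \<nu>" and "contraction \<nu> B" "contraction \<nu> H" "contraction \<nu> A"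
    and A: "A = q *\<^sub>R B + (1 - q) *\<^sub>R H" and q: "0 \<le> q" "q \<le> 1"
  shows "\<nu> (mat_pow A n *v x - q ^ n *\<^sub>R (mat_pow B n *v x)) \<le> (1 - q ^ n) * \<nu> x"
proof (induction n)
  case (Suc n)
  let ?y = "mat_pow B n *v x"
  have "q ^ n *\<^sub>R (A *v ?y) = q ^ Suc n *\<^sub>R (B *v ?y) + (q ^ n * (1 - q)) *\<^sub>R (H *v ?y)"
    unfolding A by (simp add: matrix_vector_mult_add_rdistrib scaleR_matrix_vector_mult
        scaleR_add_right mult.commute)
  then have "mat_pow A (Suc n) *v x - q ^ Suc n *\<^sub>R (mat_pow B (Suc n) *v x)
      = A *v (mat_pow A n *v x - q ^ n *\<^sub>R ?y) + (q ^ n * (1 - q)) *\<^sub>R (H *v ?y)"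
    by (simp add: mat_pow_Suc matrix_vector_mul_assoc[symmetric] matrix_vector_mult_diff_distrib
        bounded_bilinear.scaleR_right[OF bounded_bilinear_matrix_vector_mult] 
        del: mat_pow.simps)
  also have "\<nu> \<dots> \<le> \<nu> (A *v (mat_pow A n *v x - q ^ n *\<^sub>R ?y)) + q ^ n * (1 - q) * \<nu> (H *v ?y)"
    using is_norm_add[OF \<nu>] is_norm_scaleR[OF \<nu>] q by (metis abs_of_nonneg diff_ge_0_iff_ge mult_nonneg_nonneg zero_le_power)
  also have "\<nu> (A *v (mat_pow A n *v x - q ^ n *\<^sub>R ?y)) \<le> (1 - q ^ n) * \<nu> x"
    using Suc.IH assms(4) unfolding contraction_def by (meson order_trans)
  also have "q ^ n * (1 - q) * \<nu> (H *v ?y) \<le> q ^ n * (1 - q) * \<nu> x"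
    using assms(3) contraction_mat_pow[OF \<nu> assms(2)] q unfolding contraction_def
    by (intro mult_left_mono) (auto intro: order_trans)
  finally show ?case by (simp add: algebra_simps)
qed (simp add: is_norm_eq_0[OF \<nu>, THEN iffD2])

text \<open>For \<open>n \<le> N\<close> the weight \<open>q ^ n\<close> is at least
  \<open>q ^ N\<close>. Moving the surplus into the remainder gives all powers the common weight
  \<open>q ^ N\<close>, and the bounds can be averaged.\<close>

lemma cesaro_convex_combination:
  assumes \<nu>: "is_norm \<nu>" and "contraction \<nu> B" "contraction \<nu> H" "contraction \<nu> A"
    and A: "A = q *\<^sub>R B + (1 - q) *\<^sub>R H" and q: "0 \<le> q" "q \<le> 1" and "0 < N"
  shows "\<nu> (cesaro A N *v x - q ^ N *\<^sub>R (cesaro B N *v x)) \<le> (1 - q ^ N) * \<nu> x"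
proof -
  have pow: "\<nu> (mat_pow A n *v x - q ^ N *\<^sub>R (mat_pow B n *v x)) \<le> (1 - q ^ N) * \<nu> x" if "n \<le> N" for n
  proof -
    have le: "q ^ N \<le> q ^ n" using q that by (rule power_decreasing[rotated])
    have "mat_pow A n *v x - q ^ N *\<^sub>R (mat_pow B n *v x) =
        (mat_pow A n *v x - q ^ n *\<^sub>R (mat_pow B n *v x)) + (q ^ n - q ^ N) *\<^sub>R (mat_pow B n *v x)"
      by (simp add: algebra_simps)
    also have "\<nu> \<dots> \<le> \<nu> (mat_pow A n *v x - q ^ n *\<^sub>R (mat_pow B n *v x)) + (q ^ n - q ^ N) * \<nu> (mat_pow B n *v x)"
      using is_norm_add[OF \<nu>] is_norm_scaleR[OF \<nu>] le by (metis abs_of_nonneg diff_ge_0_iff_ge)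
    also have "\<dots> \<le> (1 - q ^ n) * \<nu> x + (q ^ n - q ^ N) * \<nu> x"
      using contraction_mat_pow[OF \<nu> assms(2)] le
      by (intro add_mono mult_left_mono mat_pow_convex_combination[OF assms(1-7)]) (auto simp: contraction_def)
    finally show ?thesis by (simp add: algebra_simps)
  qed
  have "cesaro A N *v x - q ^ N *\<^sub>R (cesaro B N *v x) =
      (1 / real N) *\<^sub>R (\<Sum>n=1..N. mat_pow A n *v x - q ^ N *\<^sub>R (mat_pow B n *v x))"
    by (simp add: cesaro_def scaleR_matrix_vector_mult sum_matrix_vector_mult sum_subtractf
        scaleR_sum_right scaleR_diff_right mult.commute)
  also have "\<nu> \<dots> \<le> (1 / real N) * (\<Sum>n=1..N. \<nu> (mat_pow A n *v x - q ^ N *\<^sub>R (mat_pow B n *v x)))"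
    by (auto simp: is_norm_scaleR[OF \<nu>] intro!: divide_right_mono is_norm_sum[OF \<nu>])
  also have "\<dots> \<le> (1 / real N) * (\<Sum>n=1..N. (1 - q ^ N) * \<nu> x)"
    by (intro mult_left_mono sum_mono pow) auto
  finally show ?thesis using \<open>0 < N\<close> by simp
qed

text \<open>Fixed vectors lie in the generalized eigenspace of 1 (take \<open>k = 1\<close>), which
  is a line because the eigenvalue is simple.\<close>

lemma M_E_fixed_vectors:
  assumes "A \<in> M_E \<nu> \<psi>" "\<psi> \<noteq> 0" "A *v x = x"
  shows "\<exists>c. x = c *s \<psi>"
proof -
  let ?V = "{v. \<exists>k. ((\<lambda>w. A *v w - 1 *s w) ^^ k) v = 0}"
  have dim: "vec.dim ?V = 1" and \<psi>: "A *v \<psi> = \<psi>"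
    using assms(1) by (simp_all add: M_E_def alg_mult_def)
  have V: "x \<in> ?V" "\<psi> \<in> ?V"
    using assms(3) \<psi> by (auto intro!: exI[of _ 1])
  show ?thesis
  proof (cases "x \<in> vec.span {\<psi>}")
    case True
    then show ?thesis by (auto simp: vec.span_singleton)
  next
    case False
    moreover have "vec.independent {\<psi>}" using assms(2) by simp
    ultimately have "vec.independent {x, \<psi>}" by (intro vec.independent_insert[THEN iffD2]) auto
    then have "card {x, \<psi>} \<le> vec.dim ?V"
      using V by (intro vec.independent_card_le_dim) auto
    moreover have "x \<noteq> \<psi>" using False vec.span_base[of \<psi> "{\<psi>}"] by auto
    ultimately show ?thesis using dim by simp
  qed
qed

section \<open>Fixed vectors of the expectation\<close>

lemma is_norm_matrix_vector_le:
  assumes \<nu>: "is_norm (\<nu> :: complex^'n \<Rightarrow> real)"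
  shows "\<exists>K>0. \<forall>X x. \<nu> (X *v x) \<le> K * norm X * \<nu> x"
proof -
  obtain K1 where K1: "K1 > 0" "\<And>x. \<nu> x \<le> K1 * norm x" using is_norm_le_norm[OF \<nu>] by blast
  obtain K2 where K2: "K2 > 0" "\<And>x. norm x \<le> K2 * \<nu> x" using norm_le_is_norm[OF \<nu>] by blast
  obtain K3 where K3: "K3 > 0" "\<And>X x. norm ((X :: complex^'n^'n) *v x) \<le> norm X * norm x * K3"
    using bounded_bilinear.pos_bounded[OF bounded_bilinear_matrix_vector_mult] by blast
  have "\<nu> (X *v x) \<le> (K1 * K3 * K2) * norm X * \<nu> x" for X x
  proof -
    have "\<nu> (X *v x) \<le> K1 * (norm X * norm x * K3)"
      using K1(2)[of "X *v x"] K3(2)[of X x] K1(1) by (meson mult_le_cancel_left_pos order_trans)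
    also have "\<dots> \<le> K1 * (norm X * (K2 * \<nu> x) * K3)"
      using K1(1) K2(2)[of x] K3(1) by (intro mult_left_mono mult_right_mono) auto
    finally show ?thesis by (simp add: mult_ac)
  qed
  then show ?thesis using K1(1) K2(1) K3(1) by (intro exI[of _ "K1 * K3 * K2"]) auto
qed

locale random_contraction = prob_space p for p :: "'a measure" +
  fixes \<nu> :: "complex^'n \<Rightarrow> real" and \<psi> :: "complex^'n" and M :: "'a \<Rightarrow> complex^'n^'n"
  assumes M_measurable [measurable]: "M \<in> borel_measurable p" and is_norm: "is_norm \<nu>"
    and contraction_M: "\<And>\<omega>. \<omega> \<in> space p \<Longrightarrow> contraction \<nu> (M \<omega>)"
    and norm_\<psi>: "norm \<psi> = 1"
    and M_\<psi>: "\<And>\<omega>. \<omega> \<in> space p \<Longrightarrow> M \<omega> *v \<psi> = \<psi>"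
    and pos: "measure p {\<omega> \<in> space p. M \<omega> \<in> M_E \<nu> \<psi>} > 0"
begin

definition A :: "complex^'n^'n" where "A = (\<integral>\<omega>. M \<omega> \<partial>p)"

lemma integrable_M: "integrable p M"
proof -
  obtain K where "\<And>X. contraction \<nu> X \<Longrightarrow> norm X \<le> K"
    using norm_contraction_le[OF is_norm] by blast
  then show ?thesis
    using contraction_M by (intro integrable_const_bound[of _ K] AE_I2) auto
qed

lemma expectation_vec: "integrable p f \<Longrightarrow> (\<integral>\<omega>. f \<omega> \<partial>p) *v x = (\<integral>\<omega>. f \<omega> *v x \<partial>p)"
  for f :: "'a \<Rightarrow> complex^'n^'n"
  by (rule integral_bounded_linear[symmetric])
    (rule bounded_bilinear.bounded_linear_left[OF bounded_bilinear_matrix_vector_mult])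

lemma contraction_A: "contraction \<nu> A"
  unfolding A_def using contraction_M
    expectation_in_closed_convex[OF closed_contractions[OF is_norm] convex_contractions[OF is_norm] integrable_M]
  by simp

lemma A_\<psi>: "A *v \<psi> = \<psi>"
proof -
  have "A *v \<psi> = (\<integral>\<omega>. \<psi> \<partial>p)"
    unfolding A_def expectation_vec[OF integrable_M]
    by (intro Bochner_Integration.integral_cong) (simp_all add: M_\<psi>)
  then show ?thesis by (simp add: prob_space)
qed

text \<open>\<open>B\<close> and \<open>H\<close> are the conditional means of \<open>M\<close>
  given \<open>U\<close> and given its complement.\<close>

lemma A_convex_combination:
  assumes U: "U \<in> sets p" "prob U > 0" and C: "closed C" "convex C" "\<And>\<omega>. \<omega> \<in> U \<Longrightarrow> M \<omega> \<in> C"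
  obtains B H where "B \<in> C" "contraction \<nu> B" "contraction \<nu> H"
    "A = prob U *\<^sub>R B + (1 - prob U) *\<^sub>R H"
proof -
  define V where "V = space p - U"
  have V: "V \<in> sets p" "prob V = 1 - prob U"
    using U by (auto simp: V_def prob_compl)
  let ?I = "\<lambda>W. \<integral>\<omega>. indicator W \<omega> *\<^sub>R M \<omega> \<partial>p"
  have int: "integrable p (\<lambda>\<omega>. indicator W \<omega> *\<^sub>R M \<omega>)" if "W \<in> sets p" for W
    using that integrable_M by (rule integrable_mult_indicator)
  have "A = (\<integral>\<omega>. indicator U \<omega> *\<^sub>R M \<omega> + indicator V \<omega> *\<^sub>R M \<omega> \<partial>p)"
    unfolding A_def V_def by (intro Bochner_Integration.integral_cong) (auto simp: indicator_def)
  then have sum: "A = ?I U + ?I V" using int U V by simp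
  have avg: "(1 / prob W) *\<^sub>R ?I W \<in> D"
    if "W \<in> sets p" "prob W > 0" "closed D" "convex D" "\<And>\<omega>. \<omega> \<in> W \<Longrightarrow> M \<omega> \<in> D" for W D
    using average_in_closed_convex[OF that(3,4,1,2) integrable_M that(5)] .
  have mem: "(1 / prob U) *\<^sub>R ?I U \<in> C" by (rule avg[OF U C])
  have con: "contraction \<nu> ((1 / prob W) *\<^sub>R ?I W)" if W: "W \<in> sets p" "prob W > 0" for W
    using avg[OF W closed_contractions[OF is_norm] convex_contractions[OF is_norm]] contraction_M
      sets.sets_into_space[OF W(1)] by auto
  show ?thesis
  proof (cases "prob V = 0")
    case True
    then have "AE \<omega> in p. \<omega> \<notin> V"
      using V(1) by (simp add: prob_eq_0)
    then have "AE \<omega> in p. indicator V \<omega> *\<^sub>R M \<omega> = 0" by eventually_elim simp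
    then have "?I V = 0" by (rule integral_eq_zero_AE)
    \<comment> \<open>If the complement is null, \<open>H\<close> has weight 0 and any contraction
      will do; the identity is taken.\<close>
    then have "A = prob U *\<^sub>R ((1 / prob U) *\<^sub>R ?I U) + (1 - prob U) *\<^sub>R mat 1"
      using True V(2) by (simp add: sum)
    then show ?thesis
      by (rule that[OF mem con[OF U] contraction_mat_1[OF is_norm]])
  next
    case False
    then have "prob V > 0" by (simp add: less_le)
    then have "A = prob U *\<^sub>R ((1 / prob U) *\<^sub>R ?I U) + (1 - prob U) *\<^sub>R ((1 / prob V) *\<^sub>R ?I V)"
      using U(2) by (simp add: sum V(2)[symmetric])
    then show ?thesis
      by (rule that[OF mem con[OF U] con[OF V(1) \<open>prob V > 0\<close>]])
  qed
qed

text \<open>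
  Here \<open>A = q B + (1 - q) H\<close> with \<open>B\<close> near \<open>M\<^sub>0\<close>. On the vector \<open>w'\<close>, which is fixed by \<open>A\<close> and killed
  by the projection of \<open>M\<^sub>0\<close>, the Cesaro mean of \<open>B\<close> is small; as it enters that of \<open>A\<close> with
  weight \<open>q\<^sup>N\<close>, the norm of \<open>w'\<close> would have to shrink.
\<close>

lemma A_fixed_vectors:
  assumes w: "A *v w = w"
  shows "\<exists>c. w = c *s \<psi>"
proof -
  obtain M\<^sub>0 where M\<^sub>0: "M\<^sub>0 \<in> M_E \<nu> \<psi>"
    "\<And>e. e > 0 \<Longrightarrow> prob {\<omega> \<in> space p. dist M\<^sub>0 (M \<omega>) < e} > 0"
    using exists_support_point[OF M_measurable pos] by blast
  define P\<^sub>0 where "P\<^sub>0 = riesz_projection M\<^sub>0 1"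
  have contr: "contraction \<nu> M\<^sub>0" using M\<^sub>0(1) by (simp add: M_E_def)
  interpret P\<^sub>0: absorbing_projection M\<^sub>0 P\<^sub>0
    unfolding P\<^sub>0_def by (rule absorbing_projection_riesz[OF is_norm contr])
  have "\<psi> \<noteq> 0" using norm_\<psi> by auto
  then obtain c where c: "P\<^sub>0 *v w = c *s \<psi>"
    using M_E_fixed_vectors[OF M\<^sub>0(1)] P\<^sub>0.A_P_vec by blast
  \<comment> \<open>The subtracted vector is fixed by \<open>M\<^sub>0\<close>, hence a multiple of
    \<open>\<psi>\<close>, hence fixed by \<open>A\<close> as well.\<close>
  define w' where "w' = w - P\<^sub>0 *v w"
  have w': "A *v w' = w'" "P\<^sub>0 *v w' = 0"
    using w A_\<psi> by (simp add: w'_def matrix_vector_mult_diff_distrib c vector_scalar_commute)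
      (simp add: w'_def matrix_vector_mult_diff_distrib)
  obtain K where K: "K > 0" "\<And>X x. \<nu> (X *v x) \<le> K * norm X * \<nu> x"
    using is_norm_matrix_vector_le[OF is_norm] by blast
  \<comment> \<open>With this \<open>\<delta>\<close>, a Cesaro mean that is
    \<open>\<delta>\<close>-close to \<open>P\<^sub>0\<close> sends \<open>w'\<close> to a vector of
    at most half its size.\<close>
  define \<delta> where "\<delta> = 1 / (2 * K)"
  have \<delta>: "\<delta> > 0" using K(1) by (simp add: \<delta>_def)
  \<comment> \<open>The order of choices matters: first \<open>N\<close> from
    \<open>M\<^sub>0\<close>, then the neighbourhood by continuity for this fixed \<open>N\<close>,
    so that the weight \<open>prob U ^ N\<close> stays positive.\<close>
  have "\<forall>\<^sub>F N in sequentially. 0 < N \<and> dist (cesaro M\<^sub>0 N) P\<^sub>0 < \<delta> / 2"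
    using tendstoD[OF cesaro_tendsto_riesz[OF is_norm contr], of "\<delta> / 2"] \<delta>
    by (intro eventually_conj eventually_gt_at_top) (simp add: P\<^sub>0_def)
  then obtain N where N: "0 < N" "dist (cesaro M\<^sub>0 N) P\<^sub>0 < \<delta> / 2"
    by (auto simp: eventually_sequentially)
  have "isCont (\<lambda>B. cesaro B N) M\<^sub>0"
    using continuous_on_cesaro continuous_on_eq_continuous_at open_UNIV by blast
  then obtain \<epsilon> where \<epsilon>: "\<epsilon> > 0" "\<And>B. dist B M\<^sub>0 < \<epsilon> \<Longrightarrow> dist (cesaro B N) (cesaro M\<^sub>0 N) < \<delta> / 2"
    using \<delta> unfolding continuous_at_eps_delta by (metis half_gt_zero)
  \<comment> \<open>The half radius leaves room for \<open>B\<close>, which is only known to lie in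
    the closed ball.\<close>
  define U where "U = {\<omega> \<in> space p. dist M\<^sub>0 (M \<omega>) < \<epsilon> / 2}"
  have U: "U \<in> sets p" "prob U > 0"
    using M\<^sub>0(2)[of "\<epsilon> / 2"] \<epsilon>(1) by (auto simp: U_def)
  obtain B H where BH: "B \<in> cball M\<^sub>0 (\<epsilon> / 2)" "contraction \<nu> B" "contraction \<nu> H"
      "A = prob U *\<^sub>R B + (1 - prob U) *\<^sub>R H"
    by (rule A_convex_combination[OF U closed_cball[of M\<^sub>0 "\<epsilon> / 2"] convex_cball]) (auto simp: U_def)
  define t where "t = prob U ^ N"
  have t: "t > 0" using U(2) by (simp add: t_def)
  have "dist (cesaro B N) P\<^sub>0 < \<delta>"
    using \<epsilon>(2)[of B] BH(1) \<epsilon>(1) N(2) dist_triangle[of "cesaro B N" P\<^sub>0 "cesaro M\<^sub>0 N"]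
    by (simp add: dist_commute)
  then have "norm (cesaro B N - P\<^sub>0) \<le> \<delta>" by (simp add: dist_norm)
  then have "K * norm (cesaro B N - P\<^sub>0) * \<nu> w' \<le> K * \<delta> * \<nu> w'"
    using K(1) is_norm_nonneg[OF is_norm] by (intro mult_right_mono mult_left_mono) auto
  then have "\<nu> ((cesaro B N - P\<^sub>0) *v w') \<le> \<nu> w' / 2"
    using K(2)[of "cesaro B N - P\<^sub>0" w'] K(1) by (simp add: \<delta>_def)
  then have "\<nu> (cesaro B N *v w') \<le> \<nu> w' / 2"
    by (simp add: matrix_vector_mult_diff_rdistrib w'(2))
  then have "t * \<nu> (cesaro B N *v w') \<le> t * (\<nu> w' / 2)" using t by simp
  moreover have "\<nu> (w' - t *\<^sub>R (cesaro B N *v w')) \<le> (1 - t) * \<nu> w'"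
    using cesaro_convex_combination[OF is_norm BH(2,3) contraction_A BH(4) _ _ N(1), of w']
    by (simp add: t_def cesaro_eigenvector[OF w'(1) N(1)])
  moreover have "\<nu> w' - t * \<nu> (cesaro B N *v w') \<le> \<nu> (w' - t *\<^sub>R (cesaro B N *v w'))"
    using is_norm_diff_ge[OF is_norm, of w' "t *\<^sub>R (cesaro B N *v w')"] t
    by (simp add: is_norm_scaleR[OF is_norm])
  \<comment> \<open>The three inequalities combine to
    \<open>t * \<nu> w' \<le> t * \<nu> w' / 2\<close>.\<close>
  ultimately have "t * \<nu> w' \<le> 0" by (simp add: algebra_simps)
  then have "\<nu> w' = 0"
    using t is_norm_nonneg[OF is_norm, of w'] by (simp add: mult_le_0_iff)
  then have "w' = 0" using is_norm_eq_0[OF is_norm] by simp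
  then show ?thesis using c by (auto simp: w'_def)
qed

end

section \<open>A law of large numbers for orthogonal increments\<close>

text \<open>Between consecutive squares at most \<open>2 * k\<close> terms are added to the first
  \<open>k\<^sup>2\<close>; they contribute at most \<open>2 * k * K\<close>, negligible against
  \<open>k\<^sup>2\<close>.\<close>

lemma averages_tendsto_0_from_squares:
  fixes d :: "nat \<Rightarrow> 'b::real_normed_vector"
  assumes bound: "\<And>n. norm (d n) \<le> K"
    and squares: "(\<lambda>k. norm (\<Sum>n<k\<^sup>2. d n) / (real k)\<^sup>2) \<longlonglongrightarrow> 0"
  shows "(\<lambda>N. (1 / real N) *\<^sub>R (\<Sum>n<N. d n)) \<longlonglongrightarrow> 0"
proof -
  have K: "K \<ge> 0" using bound[of 0] norm_ge_zero[of "d 0"] by linarith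
  let ?g = "\<lambda>k. norm (\<Sum>n<k\<^sup>2. d n) / (real k)\<^sup>2 + 2 * K / real k"
  have root: "filterlim floor_sqrt at_top sequentially"
    unfolding filterlim_at_top
  proof
    fix k :: nat
    show "\<forall>\<^sub>F n in sequentially. k \<le> floor_sqrt n"
      using eventually_ge_at_top[of "k\<^sup>2"] by eventually_elim (rule le_floor_sqrtI)
  qed
  have "?g \<longlonglongrightarrow> 0 + 0"
    by (intro tendsto_add squares lim_const_over_n)
  then have lim: "(\<lambda>N. ?g (floor_sqrt N)) \<longlonglongrightarrow> 0"
    using filterlim_compose[OF _ root] by simp
  have "norm ((1 / real N) *\<^sub>R (\<Sum>n<N. d n)) \<le> ?g (floor_sqrt N)" if "N \<ge> 1" for N
  proof -
    define k where "k = floor_sqrt N"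
    have k: "k\<^sup>2 \<le> N" "k \<ge> 1"
      using floor_sqrt_power2_le[of N] that by (auto simp: k_def Suc_le_eq)
    have "N < (Suc k)\<^sup>2" unfolding k_def by (rule Suc_floor_sqrt_power2_gt)
    then have gap: "N - k\<^sup>2 \<le> 2 * k" by (simp add: power2_eq_square)
    have split: "(\<Sum>n<N. d n) = (\<Sum>n<k\<^sup>2. d n) + (\<Sum>n=k\<^sup>2..<N. d n)"
      using k(1) by (simp add: lessThan_atLeast0 sum.atLeastLessThan_concat)
    have "norm (\<Sum>n=k\<^sup>2..<N. d n) \<le> real (N - k\<^sup>2) * K"
      using sum_norm_bound[of "{k\<^sup>2..<N}" d K] bound by simp
    moreover have "real (N - k\<^sup>2) * K \<le> 2 * real k * K"
      using gap K by (intro mult_right_mono) linarith+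
    ultimately have "norm (\<Sum>n<N. d n) \<le> norm (\<Sum>n<k\<^sup>2. d n) + 2 * real k * K"
      using norm_triangle_ineq[of "\<Sum>n<k\<^sup>2. d n" "\<Sum>n=k\<^sup>2..<N. d n"] unfolding split by linarith
    then have "norm (\<Sum>n<N. d n) / real N \<le> (norm (\<Sum>n<k\<^sup>2. d n) + 2 * real k * K) / real N"
      by (rule divide_right_mono) simp
    also have "\<dots> \<le> (norm (\<Sum>n<k\<^sup>2. d n) + 2 * real k * K) / (real k)\<^sup>2"
    proof (rule divide_left_mono)
      show "(real k)\<^sup>2 \<le> real N" using k(1) by (metis of_nat_le_iff of_nat_power)
    qed (use k K that in auto)
    also have "\<dots> = ?g k" using k(2) by (simp add: field_simps power2_eq_square)
    finally show ?thesis by (simp add: k_def)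
  qed
  then show ?thesis
    by (intro Lim_null_comparison[OF _ lim] eventually_mono[OF eventually_ge_at_top[of 1]]) auto
qed

context prob_space
begin

text \<open>Pythagoras: the mixed terms integrate to 0 and each diagonal term is at most
  \<open>K\<^sup>2\<close>.\<close>

lemma orthogonal_second_moment:
  fixes d :: "nat \<Rightarrow> 'a \<Rightarrow> 'b::euclidean_space"
  assumes d [measurable]: "\<And>n. d n \<in> borel_measurable M"
    and bound: "\<And>n x. x \<in> space M \<Longrightarrow> norm (d n x) \<le> K"
    and orth: "\<And>m n. m < n \<Longrightarrow> (\<integral>x. d m x \<bullet> d n x \<partial>M) = 0"
  shows "integrable M (\<lambda>x. (norm (\<Sum>n<N. d n x))\<^sup>2) \<and>
    (\<integral>x. (norm (\<Sum>n<N. d n x))\<^sup>2 \<partial>M) \<le> real N * K\<^sup>2"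
proof (induction N)
  case (Suc N)
  have prod: "\<bar>d m x \<bullet> d n x\<bar> \<le> K * K" if "x \<in> space M" for m n x
    using Cauchy_Schwarz_ineq2[of "d m x" "d n x"] bound[OF that, of m] bound[OF that, of n]
    by (meson mult_mono norm_ge_zero order_trans)
  have int: "integrable M (\<lambda>x. d m x \<bullet> d n x)" for m n
    using prod by (intro integrable_const_bound[of _ "K * K"] AE_I2) auto
  have eq: "(norm (\<Sum>n<Suc N. d n x))\<^sup>2 =
      (norm (\<Sum>n<N. d n x))\<^sup>2 + 2 * (\<Sum>m<N. d m x \<bullet> d N x) + d N x \<bullet> d N x" for x
    by (simp add: power2_norm_eq_inner inner_add_left inner_add_right inner_sum_left inner_sum_right
        inner_commute)
  have int_sum: "integrable M (\<lambda>x. 2 * (\<Sum>m<N. d m x \<bullet> d N x))"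
    using int by (intro integrable_mult_right Bochner_Integration.integrable_sum)
  have "(\<integral>x. (norm (\<Sum>n<Suc N. d n x))\<^sup>2 \<partial>M) =
      (\<integral>x. (norm (\<Sum>n<N. d n x))\<^sup>2 \<partial>M) + (\<integral>x. d N x \<bullet> d N x \<partial>M)"
    unfolding eq using Suc.IH int int_sum by (simp add: orth)
  also have "(\<integral>x. d N x \<bullet> d N x \<partial>M) \<le> (\<integral>x. K * K \<partial>M)"
    using prod[of _ N N] int by (intro integral_mono) (auto simp: abs_le_iff)
  finally have "(\<integral>x. (norm (\<Sum>n<Suc N. d n x))\<^sup>2 \<partial>M) \<le> real (Suc N) * K\<^sup>2"
    using Suc.IH by (simp add: prob_space algebra_simps power2_eq_square)
  moreover have "integrable M (\<lambda>x. (norm (\<Sum>n<Suc N. d n x))\<^sup>2)"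
    unfolding eq using Suc.IH int int_sum by auto
  ultimately show ?case by blast
qed simp

text \<open>The average of the first \<open>(Suc k)\<^sup>2\<close> terms has second moment at most
  \<open>K\<^sup>2 / (Suc k)\<^sup>2\<close>, which is summable in \<open>k\<close>. Hence its
  squared norms are almost surely summable and tend to 0; boundedness then bridges the gaps between
  squares.\<close>

lemma orthogonal_law_of_large_numbers:
  fixes d :: "nat \<Rightarrow> 'a \<Rightarrow> 'b::euclidean_space"
  assumes d [measurable]: "\<And>n. d n \<in> borel_measurable M"
    and bound: "\<And>n x. x \<in> space M \<Longrightarrow> norm (d n x) \<le> K"
    and orth: "\<And>m n. m < n \<Longrightarrow> (\<integral>x. d m x \<bullet> d n x \<partial>M) = 0"
  shows "AE x in M. (\<lambda>N. (1 / real N) *\<^sub>R (\<Sum>n<N. d n x)) \<longlonglongrightarrow> 0"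
proof -
  \<comment> \<open>\<open>Suc k\<close> keeps the denominators nonzero; the shift is undone by
    \<open>filterlim_sequentially_Suc\<close>.\<close>
  define f where "f k x = (norm (\<Sum>n<(Suc k)\<^sup>2. d n x) / (real (Suc k))\<^sup>2)\<^sup>2" for k x
  have f [measurable]: "f k \<in> borel_measurable M" for k unfolding f_def by measurable
  have "(\<integral>\<^sup>+x. ennreal (f k x) \<partial>M) \<le> ennreal (K\<^sup>2 * inverse ((real (Suc k))\<^sup>2))" for k
  proof -
    have moment: "integrable M (\<lambda>x. (norm (\<Sum>n<(Suc k)\<^sup>2. d n x))\<^sup>2)"
      "(\<integral>x. (norm (\<Sum>n<(Suc k)\<^sup>2. d n x))\<^sup>2 \<partial>M) \<le> real ((Suc k)\<^sup>2) * K\<^sup>2"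
      using orthogonal_second_moment[where d = d and K = K and N = "(Suc k)\<^sup>2", OF d bound orth]
      by simp_all
    have "(\<integral>x. f k x \<partial>M) = (\<integral>x. (norm (\<Sum>n<(Suc k)\<^sup>2. d n x))\<^sup>2 \<partial>M) / ((real (Suc k))\<^sup>2)\<^sup>2"
      by (simp add: f_def power_divide)
    also have "\<dots> \<le> (real ((Suc k)\<^sup>2) * K\<^sup>2) / ((real (Suc k))\<^sup>2)\<^sup>2"
      using moment(2) by (rule divide_right_mono) simp
    also have "\<dots> = K\<^sup>2 * inverse ((real (Suc k))\<^sup>2)"
    proof -
      have "b * K\<^sup>2 / b\<^sup>2 = K\<^sup>2 * inverse b" if "b \<noteq> 0" for b :: real
        using that by (simp add: field_simps power2_eq_square)
      from this[of "(real (Suc k))\<^sup>2"] show ?thesis by (simp only: of_nat_power) simp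
    qed
    finally have "ennreal (\<integral>x. f k x \<partial>M) \<le> ennreal (K\<^sup>2 * inverse ((real (Suc k))\<^sup>2))"
      by (rule ennreal_leI)
    moreover have "(\<integral>\<^sup>+x. ennreal (f k x) \<partial>M) = ennreal (\<integral>x. f k x \<partial>M)"
      using moment(1) by (intro nn_integral_eq_integral) (auto simp: f_def power_divide)
    ultimately show ?thesis by simp
  qed
  then have "(\<integral>\<^sup>+x. (\<Sum>k. ennreal (f k x)) \<partial>M) \<le> (\<Sum>k. ennreal (K\<^sup>2 * inverse ((real (Suc k))\<^sup>2)))"
    by (subst nn_integral_suminf) (auto intro!: suminf_le)
  also have "\<dots> = ennreal (\<Sum>k. K\<^sup>2 * inverse ((real (Suc k))\<^sup>2))"
  proof (rule suminf_ennreal2)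
    have "summable (\<lambda>n. inverse ((real n)\<^sup>2))" by (rule inverse_power_summable) simp
    then have "summable (\<lambda>n. inverse ((real (Suc n))\<^sup>2))" by (subst summable_Suc_iff)
    then show "summable (\<lambda>n. K\<^sup>2 * inverse ((real (Suc n))\<^sup>2))" by (rule summable_mult)
  qed simp
  finally have "(\<integral>\<^sup>+x. (\<Sum>k. ennreal (f k x)) \<partial>M) \<noteq> \<infinity>"
    by (auto simp: top_unique)
  then have "AE x in M. (\<Sum>k. ennreal (f k x)) \<noteq> \<infinity>"
    by (intro nn_integral_PInf_AE) measurable
  moreover have "AE x in M. x \<in> space M" by simp
  ultimately show ?thesis
  proof eventually_elim
    case (elim x)
    have "summable (\<lambda>k. f k x)"
      using elim(1) by (intro summable_suminf_not_top) (auto simp: f_def)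
    then have "(\<lambda>k. sqrt (f k x)) \<longlonglongrightarrow> sqrt 0"
      by (intro tendsto_real_sqrt summable_LIMSEQ_zero)
    then have "(\<lambda>k. norm (\<Sum>n<(Suc k)\<^sup>2. d n x) / (real (Suc k))\<^sup>2) \<longlonglongrightarrow> 0"
      by (simp add: f_def)
    then have "(\<lambda>k. norm (\<Sum>n<k\<^sup>2. d n x) / (real k)\<^sup>2) \<longlonglongrightarrow> 0"
      by (subst (asm) filterlim_sequentially_Suc)
    with bound[OF elim(2)] show ?case by (rule averages_tendsto_0_from_squares)
  qed
qed

end

section \<open>Random products\<close>

lemma mat_prod_cong:
  assumes "\<And>j. 1 \<le> j \<Longrightarrow> j \<le> n \<Longrightarrow> w j = w' j"
  shows "mat_prod M w n = mat_prod M w' n"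
  using assms by (induction n) auto

lemma borel_measurable_matrix_matrix_mult [measurable (raw)]:
  fixes f g :: "'a \<Rightarrow> complex^'n^'n"
  assumes "f \<in> borel_measurable N" "g \<in> borel_measurable N"
  shows "(\<lambda>x. f x ** g x) \<in> borel_measurable N"
  by (rule borel_measurable_continuous_Pair[OF assms])
    (auto intro!: continuous_on_matrix_matrix_mult continuous_intros)

context random_contraction
begin

abbreviation \<P> :: "(nat \<Rightarrow> 'a) measure" where "\<P> \<equiv> \<Pi>\<^sub>M j\<in>{1::nat..}. p"

lemma prob_space_\<P>: "prob_space \<P>"
  by (rule prob_space_PiM) (rule prob_space_axioms)

lemma in_space_p: "w \<in> space \<P> \<Longrightarrow> w (Suc n) \<in> space p"
  by (auto simp: space_PiM)

lemma measurable_M_coordinate [measurable]: "(\<lambda>w. M (w (Suc n))) \<in> borel_measurable \<P>"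
  by (rule measurable_compose[OF measurable_component_singleton]) auto

lemma measurable_mat_prod [measurable]: "(\<lambda>w. mat_prod M w n) \<in> borel_measurable \<P>"
  by (induction n) auto

lemma contraction_mat_prod: "w \<in> space \<P> \<Longrightarrow> contraction \<nu> (mat_prod M w n)"
  by (induction n) (auto intro!: contraction_mat_1 contraction_mult is_norm contraction_M in_space_p)

lemma mat_prod_\<psi>: "w \<in> space \<P> \<Longrightarrow> mat_prod M w n *v \<psi> = \<psi>"
  by (induction n) (simp_all add: M_\<psi> in_space_p flip: matrix_vector_mul_assoc)

text \<open>Martingale differences: the last factor is centred and independent of the product before it.\<close>

definition increment :: "nat \<Rightarrow> (nat \<Rightarrow> 'a) \<Rightarrow> complex^'n^'n" where
  "increment n w = mat_prod M w n ** (M (w (Suc n)) - A)"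

lemma measurable_increment [measurable]: "increment n \<in> borel_measurable \<P>"
  unfolding increment_def by measurable

text \<open>Each increment is the product of \<open>n + 1\<close> factors minus the product of
  \<open>n\<close> factors times \<open>A\<close>, a difference of two contractions.\<close>

lemma increment_bounded: "\<exists>K. \<forall>n. \<forall>w\<in>space \<P>. norm (increment n w) \<le> K"
proof -
  obtain K where K: "\<And>X. contraction \<nu> X \<Longrightarrow> norm X \<le> K"
    using norm_contraction_le[OF is_norm] by blast
  have "norm (increment n w) \<le> K + K" if "w \<in> space \<P>" for n w
  proof -
    have "increment n w = mat_prod M w (Suc n) - mat_prod M w n ** A"
      by (simp add: increment_def bounded_bilinear.diff_right[OF bounded_bilinear_matrix_matrix_mult])
    then have "norm (increment n w) = norm (mat_prod M w (Suc n) - mat_prod M w n ** A)" by simp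
    moreover have "norm (mat_prod M w (Suc n)) \<le> K" "norm (mat_prod M w n ** A) \<le> K"
      by (intro K contraction_mult[OF is_norm] contraction_mat_prod[OF that] contraction_A)+
    ultimately show ?thesis
      using norm_triangle_ineq4[of "mat_prod M w (Suc n)" "mat_prod M w n ** A"] by linarith
  qed
  then show ?thesis by blast
qed

text \<open>By Fubini the coordinate \<open>Suc n\<close> can be integrated first. It enters only
  through the centred last factor of the later increment, whose mean is 0.\<close>

lemma increment_orthogonal:
  assumes "m < n"
  shows "(\<integral>w. increment m w \<bullet> increment n w \<partial>\<P>) = 0"
proof -
  interpret \<P>: prob_space \<P> by (rule prob_space_\<P>)
  define \<P>' where "\<P>' = (\<Pi>\<^sub>M j\<in>{1..} - {Suc n}. p)"
  interpret \<P>': prob_space \<P>' unfolding \<P>'_def by (rule prob_space_PiM) (rule prob_space_axioms)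
  interpret pair_sigma_finite p \<P>' by unfold_locales
  \<comment> \<open>The coordinate \<open>Suc n\<close> is split off: \<open>\<P>\<close> is the
    image of \<open>p\<close> times the product over the other coordinates.\<close>
  have insert: "insert (Suc n) ({1..} - {Suc n}) = {1..}" by auto
  let ?upd = "\<lambda>(x, v). v(Suc n := x) :: nat \<Rightarrow> 'a"
  have distr: "distr (p \<Otimes>\<^sub>M \<P>') \<P> ?upd = \<P>"
    using distr_pair_PiM_eq_PiM[of "{1..} - {Suc n}" "\<lambda>_. p" "Suc n"] prob_space_axioms
    unfolding insert \<P>'_def by simp
  have upd: "?upd \<in> measurable (p \<Otimes>\<^sub>M \<P>') \<P>"
    unfolding \<P>'_def case_prod_beta'
    by (rule measurable_fun_upd[where J = "{1..} - {Suc n}"]) auto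
  let ?f = "\<lambda>w. increment m w \<bullet> increment n w"
  obtain K where K: "\<And>n w. w \<in> space \<P> \<Longrightarrow> norm (increment n w) \<le> K"
    using increment_bounded by blast
  have "\<bar>?f w\<bar> \<le> K * K" if "w \<in> space \<P>" for w
    using Cauchy_Schwarz_ineq2[of "increment m w" "increment n w"] K[OF that, of m] K[OF that, of n]
    by (meson mult_mono norm_ge_zero order_trans)
  then have "integrable \<P> ?f"
    by (intro \<P>.integrable_const_bound[of _ "K * K"] AE_I2 borel_measurable_inner
        measurable_increment) simp
  then have "integrable (p \<Otimes>\<^sub>M \<P>') (\<lambda>z. ?f (?upd z))"
    by (rule integrable_distr[OF upd, unfolded distr])
  then have int: "integrable (p \<Otimes>\<^sub>M \<P>') (\<lambda>(x, v). ?f (v(Suc n := x)))"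
    by (simp add: case_prod_beta')
  have integrable_diff: "integrable p (\<lambda>x. M x - A)" using integrable_M by simp
  have inner: "(\<integral>x. ?f (v(Suc n := x)) \<partial>p) = 0" for v
  proof -
    have past: "mat_prod M (v(Suc n := x)) k = mat_prod M v k" if "k \<le> n" for k x
      using that by (intro mat_prod_cong) auto
    \<comment> \<open>The earlier increment reads coordinates up to \<open>Suc m\<close> only, and
      \<open>m < n\<close>.\<close>
    have "increment m (v(Suc n := x)) = increment m v" for x
      using assms past by (simp add: increment_def)
    moreover have "increment n (v(Suc n := x)) = mat_prod M v n ** (M x - A)" for x
      using past by (simp add: increment_def)
    ultimately have "(\<integral>x. ?f (v(Suc n := x)) \<partial>p) =
        (\<integral>x. increment m v \<bullet> (mat_prod M v n ** (M x - A)) \<partial>p)"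
      by simp
    also have "\<dots> = increment m v \<bullet> (mat_prod M v n ** (\<integral>x. M x - A \<partial>p))"
      using bounded_linear_compose[OF bounded_linear_inner_right
          bounded_bilinear.bounded_linear_right[OF bounded_bilinear_matrix_matrix_mult]] integrable_diff
      by (rule integral_bounded_linear)
    also have "(\<integral>x. M x - A \<partial>p) = 0"
      using integrable_M by (simp add: prob_space A_def)
    also have "increment m v \<bullet> (mat_prod M v n ** 0) = 0"
      by (simp add: bounded_bilinear.zero_right[OF bounded_bilinear_matrix_matrix_mult])
    finally show ?thesis .
  qed
  have "(\<integral>w. ?f w \<partial>\<P>) = (\<integral>z. ?f (?upd z) \<partial>(p \<Otimes>\<^sub>M \<P>'))"
    by (rule integral_distr[OF upd, of ?f, unfolded distr])
      (intro borel_measurable_inner measurable_increment)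
  also have "\<dots> = (\<integral>v. (\<integral>x. ?f (v(Suc n := x)) \<partial>p) \<partial>\<P>')"
    using integral_snd[OF int] by (simp add: case_prod_beta')
  finally show ?thesis by (simp add: inner)
qed

definition average :: "(nat \<Rightarrow> 'a) \<Rightarrow> nat \<Rightarrow> complex^'n^'n" where
  "average w N = (1 / real N) *\<^sub>R (\<Sum>n=1..N. mat_prod M w n)"

lemma average_mult_1_minus_A:
  "AE w in \<P>. (\<lambda>N. average w N ** (mat 1 - A)) \<longlonglongrightarrow> 0"
proof -
  interpret \<P>: prob_space \<P> by (rule prob_space_\<P>)
  obtain K where K: "\<And>n w. w \<in> space \<P> \<Longrightarrow> norm (increment n w) \<le> K"
    using increment_bounded by blast
  obtain K' where K': "\<And>X. contraction \<nu> X \<Longrightarrow> norm X \<le> K'"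
    using norm_contraction_le[OF is_norm] by blast
  have "AE w in \<P>. (\<lambda>N. (1 / real N) *\<^sub>R (\<Sum>n<N. increment n w)) \<longlonglongrightarrow> 0"
    using measurable_increment K increment_orthogonal by (rule \<P>.orthogonal_law_of_large_numbers)
  moreover have "AE w in \<P>. w \<in> space \<P>" by (rule AE_space)
  ultimately show ?thesis
  proof eventually_elim
    case (elim w)
    \<comment> \<open>One sum runs over products of length 1 to \<open>N\<close>, the other over
      lengths 0 to \<open>N - 1\<close>. Aligning them leaves a bounded boundary term, negligible
      after division by \<open>N\<close>.\<close>
    have "(\<Sum>n<N. increment n w) =
        (\<Sum>n=1..N. mat_prod M w n) ** (mat 1 - A) + (mat_prod M w N - mat 1) ** A" for N
      by (induction N)
        (simp_all add: increment_def matrix_mul_assoc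
          bounded_bilinear.add_left[OF bounded_bilinear_matrix_matrix_mult]
          bounded_bilinear.diff_left[OF bounded_bilinear_matrix_matrix_mult]
          bounded_bilinear.diff_right[OF bounded_bilinear_matrix_matrix_mult])
    then have eq: "average w N ** (mat 1 - A) = (1 / real N) *\<^sub>R (\<Sum>n<N. increment n w)
        - (1 / real N) *\<^sub>R ((mat_prod M w N - mat 1) ** A)" for N
      by (simp add: average_def bounded_bilinear.scaleR_left[OF bounded_bilinear_matrix_matrix_mult]
          scaleR_add_right)
    have "(\<lambda>N. (1 / real N) *\<^sub>R ((mat_prod M w N - mat 1) ** A)) \<longlonglongrightarrow> 0"
    proof (rule tendsto_scaleR_over_n)
      fix N
      have "(mat_prod M w N - mat 1) ** A = mat_prod M w N ** A - A"
        by (simp add: bounded_bilinear.diff_left[OF bounded_bilinear_matrix_matrix_mult])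
      then have "norm ((mat_prod M w N - mat 1) ** A) = norm (mat_prod M w N ** A - A)" by simp
      moreover have "norm (mat_prod M w N ** A) \<le> K'" "norm A \<le> K'"
        by (intro K' contraction_mult[OF is_norm] contraction_mat_prod[OF elim(2)] contraction_A)+
      ultimately show "norm ((mat_prod M w N - mat 1) ** A) \<le> K' + K'"
        using norm_triangle_ineq4[of "mat_prod M w N ** A" A] by linarith
    qed
    from tendsto_diff[OF elim(1) this] show ?case unfolding eq by simp
  qed
qed

end

section \<open>Identification of the limit\<close>

context random_contraction
begin

definition P1 :: "complex^'n^'n" where "P1 = riesz_projection A 1"
definition E\<psi> :: "complex^'n" where "E\<psi> = (\<integral>\<omega>. psi_of \<psi> (M \<omega>) \<partial>p)"
definition EMQ :: "complex^'n^'n" where "EMQ = (\<integral>\<omega>. MQ_of \<psi> (M \<omega>) \<partial>p)"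
text \<open>Of the three descriptions of this vector the one easiest to pair with is taken as
  definition; \<open>\<theta>_eq_resolvent\<close> and \<open>adj_P1_E\<psi>\<close> supply the
  others.\<close>

definition \<theta> :: "complex^'n" where "\<theta> = adj P1 *v \<psi>"

sublocale P1: absorbing_projection A P1
  unfolding P1_def by (rule absorbing_projection_riesz[OF is_norm contraction_A])

lemma cinner_\<psi>_\<psi> [simp]: "cinner \<psi> \<psi> = 1"
  by (simp add: cinner_self norm_\<psi>)

lemma cinner_psi_of: "cinner (psi_of \<psi> B) x = cinner \<psi> (riesz_projection B 1 *v x)"
  by (simp add: psi_of_def cinner_adj)

lemma cinner_psi_of_\<psi>: "\<omega> \<in> space p \<Longrightarrow> cinner (psi_of \<psi> (M \<omega>)) \<psi> = 1"
  using absorbing_projection.fixed[OF absorbing_projection_riesz[OF is_norm contraction_M] M_\<psi>]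
  by (simp add: cinner_psi_of)

lemma cinner_psi_of_M:
  "\<omega> \<in> space p \<Longrightarrow> cinner (psi_of \<psi> (M \<omega>)) (M \<omega> *v x) = cinner (psi_of \<psi> (M \<omega>)) x"
  using absorbing_projection.P_A_vec[OF absorbing_projection_riesz[OF is_norm contraction_M]]
  by (simp add: cinner_psi_of)

text \<open>The Riesz projection is a pointwise limit of continuous functions of
  \<open>M \<omega>\<close> with a common bound, hence measurable and bounded.\<close>

lemma integrable_psi_of: "integrable p (\<lambda>\<omega>. psi_of \<psi> (M \<omega>))"
proof -
  obtain K where K: "\<And>X. contraction \<nu> X \<Longrightarrow> norm X \<le> K"
    using norm_contraction_le[OF is_norm] by blast
  have lim: "cesaro (M \<omega>) \<longlonglongrightarrow> riesz_projection (M \<omega>) 1" if "\<omega> \<in> space p" for \<omega>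
    using that by (intro cesaro_tendsto_riesz[OF is_norm contraction_M])
  have "(\<lambda>\<omega>. riesz_projection (M \<omega>) 1) \<in> borel_measurable p"
  proof (rule borel_measurable_LIMSEQ_metric)
    show "(\<lambda>\<omega>. cesaro (M \<omega>) N) \<in> borel_measurable p" for N
      by (rule measurable_compose[OF M_measurable borel_measurable_continuous_onI[OF continuous_on_cesaro]])
    show "(\<lambda>N. cesaro (M \<omega>) N) \<longlonglongrightarrow> riesz_projection (M \<omega>) 1" if "\<omega> \<in> space p" for \<omega>
      using lim[OF that] .
  qed
  moreover have "norm (riesz_projection (M \<omega>) 1) \<le> K" if "\<omega> \<in> space p" for \<omega>
  proof (rule Lim_bounded)
    show "(\<lambda>N. norm (cesaro (M \<omega>) N)) \<longlonglongrightarrow> norm (riesz_projection (M \<omega>) 1)"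
      using lim[OF that] by (rule tendsto_norm)
    show "\<forall>N\<ge>1. norm (cesaro (M \<omega>) N) \<le> K"
      using K contraction_cesaro[OF is_norm contraction_M[OF that]] by auto
  qed
  ultimately have "integrable p (\<lambda>\<omega>. riesz_projection (M \<omega>) 1)"
    by (intro integrable_const_bound[of _ K] AE_I2)
  then show ?thesis
    unfolding psi_of_def
    by (intro integrable_bounded_linear[OF bounded_bilinear.bounded_linear_left[OF bounded_bilinear_matrix_vector_mult]]
        integrable_bounded_linear[OF bounded_linear_adj])
qed

lemma cinner_E\<psi>_\<psi>: "cinner E\<psi> \<psi> = 1"
proof -
  \<comment> \<open>The integral passes through the linear second argument; conjugate symmetry then
    swaps the arguments.\<close>
  have "cinner \<psi> E\<psi> = (\<integral>\<omega>. cinner \<psi> (psi_of \<psi> (M \<omega>)) \<partial>p)"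
    unfolding E\<psi>_def
    by (rule integral_bounded_linear[OF bounded_linear_cinner_right integrable_psi_of, symmetric])
  also have "\<dots> = (\<integral>\<omega>. 1 \<partial>p)"
    by (intro Bochner_Integration.integral_cong)
      (simp_all add: cinner_commute[of \<psi> "psi_of \<psi> _"] cinner_psi_of_\<psi>)
  finally show ?thesis by (simp add: prob_space cinner_commute[of E\<psi>])
qed

text \<open>Pairing with \<open>psi_of\<close> is invariant under \<open>M \<omega>\<close> and
  equals 1 at \<open>\<psi>\<close>, so the left factor \<open>Q_of\<close> acts trivially. This
  covers also those \<open>\<omega>\<close> with \<open>M \<omega>\<close> outside
  \<open>M_E\<close>, where the eigenvalue 1 may be multiple.\<close>

lemma MQ_of_eq:
  assumes "\<omega> \<in> space p"
  shows "MQ_of \<psi> (M \<omega>) = M \<omega> - ketbra \<psi> (psi_of \<psi> (M \<omega>))"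
proof (rule matrix_eqI)
  fix x
  let ?\<phi> = "psi_of \<psi> (M \<omega>)"
  have Q: "Q_of \<psi> (M \<omega>) *v y = y - cinner ?\<phi> y *s \<psi>" for y
    by (simp add: Q_of_def P_of_def matrix_vector_mult_diff_rdistrib ketbra_mult_vec)
  have "M \<omega> *v (x - cinner ?\<phi> x *s \<psi>) = M \<omega> *v x - cinner ?\<phi> x *s \<psi>"
    using assms by (simp add: matrix_vector_mult_diff_distrib vector_scalar_commute M_\<psi>)
  moreover have "cinner ?\<phi> (M \<omega> *v (x - cinner ?\<phi> x *s \<psi>)) = 0"
    using assms
    by (simp only: cinner_psi_of_M cinner_diff_right cinner_scale_right cinner_psi_of_\<psi>) simp
  ultimately show "MQ_of \<psi> (M \<omega>) *v x = (M \<omega> - ketbra \<psi> ?\<phi>) *v x"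
    by (simp add: MQ_of_def Q matrix_vector_mult_diff_rdistrib ketbra_mult_vec
        flip: matrix_vector_mul_assoc)
qed

lemma EMQ_eq: "EMQ = A - ketbra \<psi> E\<psi>"
proof -
  have "EMQ = (\<integral>\<omega>. M \<omega> - ketbra \<psi> (psi_of \<psi> (M \<omega>)) \<partial>p)"
    unfolding EMQ_def by (intro Bochner_Integration.integral_cong) (simp_all add: MQ_of_eq)
  also have "\<dots> = A - (\<integral>\<omega>. ketbra \<psi> (psi_of \<psi> (M \<omega>)) \<partial>p)"
    unfolding A_def using integrable_M
      integrable_bounded_linear[OF bounded_linear_ketbra_right integrable_psi_of]
    by (rule Bochner_Integration.integral_diff)
  also have "(\<integral>\<omega>. ketbra \<psi> (psi_of \<psi> (M \<omega>)) \<partial>p) = ketbra \<psi> E\<psi>"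
    unfolding E\<psi>_def
    by (rule integral_bounded_linear[OF bounded_linear_ketbra_right integrable_psi_of])
  finally show ?thesis .
qed

lemma one_minus_EMQ_vec: "(mat 1 - EMQ) *v x = x - A *v x + cinner E\<psi> x *s \<psi>"
  by (simp add: EMQ_eq matrix_vector_mult_diff_rdistrib ketbra_mult_vec)

section \<open>Invertibility of \<open>mat 1 - EMQ\<close> and the formulas for
  \<open>\<theta>\<close>\<close>

lemma P1_\<psi>: "P1 *v \<psi> = \<psi>"
  by (rule P1.fixed[OF A_\<psi>])

text \<open>\<open>P1\<close> annihilates \<open>mat 1 - A\<close> and fixes \<open>\<psi>\<close>.
  So \<open>P1\<close> solves the equation that the averages satisfy in the limit.\<close>

lemma P1_one_minus_EMQ: "P1 ** (mat 1 - EMQ) = ketbra \<psi> E\<psi>"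
  by (rule matrix_eqI)
    (simp add: one_minus_EMQ_vec ketbra_mult_vec matrix_vector_right_distrib P1_\<psi>
      matrix_vector_mult_diff_distrib vector_scalar_commute flip: matrix_vector_mul_assoc)

text \<open>Applying \<open>P1\<close> to the kernel equation shows that a kernel vector pairs to 0
  with \<open>E\<psi>\<close> and is fixed by \<open>A\<close>. It is then a multiple of
  \<open>\<psi>\<close>, which pairs to 1 with \<open>E\<psi>\<close>, so the multiple is 0.\<close>

lemma invertible_one_minus_EMQ: "invertible (mat 1 - EMQ)"
  unfolding invertible_iff_ker
proof (intro allI impI)
  fix x assume x: "(mat 1 - EMQ) *v x = 0"
  have "cinner E\<psi> x *s \<psi> = P1 *v ((mat 1 - EMQ) *v x)"
    by (simp only: matrix_vector_mul_assoc P1_one_minus_EMQ ketbra_mult_vec)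
  then have "cinner E\<psi> x *s \<psi> = 0" by (simp add: x)
  moreover have "\<psi> \<noteq> 0" using norm_\<psi> by auto
  ultimately have *: "cinner E\<psi> x = 0" by simp
  then have "A *v x = x" using x by (simp add: one_minus_EMQ_vec)
  then obtain c where "x = c *s \<psi>" using A_fixed_vectors by blast
  with * show "x = 0" by (simp add: cinner_scale_right cinner_E\<psi>_\<psi>)
qed

lemma cinner_\<theta>: "cinner \<theta> x = cinner \<psi> (P1 *v x)"
  by (simp add: \<theta>_def cinner_adj)

text \<open>The range of \<open>P1\<close> consists of fixed vectors of \<open>A\<close>, all
  multiples of \<open>\<psi>\<close>; pairing with \<open>\<psi>\<close> determines the
  coefficient.\<close>

lemma P1_eq_ketbra: "P1 = ketbra \<psi> \<theta>"
proof (rule matrix_eqI)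
  fix x
  obtain c where "P1 *v x = c *s \<psi>"
    using A_fixed_vectors P1.A_P_vec by blast
  then show "P1 *v x = ketbra \<psi> \<theta> *v x"
    by (simp add: ketbra_mult_vec cinner_\<theta> cinner_scale_right)
qed

text \<open>This is the adjoint of \<open>P1_one_minus_EMQ\<close> evaluated at
  \<open>\<psi>\<close>.\<close>

lemma \<theta>_eq_resolvent: "matrix_inv (mat 1 - adj EMQ) *v E\<psi> = \<theta>"
proof -
  have adj: "mat 1 - adj EMQ = adj (mat 1 - EMQ)" by (simp add: adj_diff)
  have "adj (mat 1 - EMQ) *v \<theta> = E\<psi>"
  proof (rule cinner_eqI)
    fix x
    have "cinner (adj (mat 1 - EMQ) *v \<theta>) x = cinner \<psi> ((P1 ** (mat 1 - EMQ)) *v x)"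
      by (simp add: cinner_adj cinner_\<theta> matrix_vector_mul_assoc)
    then show "cinner (adj (mat 1 - EMQ) *v \<theta>) x = cinner E\<psi> x"
      by (simp add: P1_one_minus_EMQ ketbra_mult_vec cinner_scale_right)
  qed
  then have "matrix_inv (mat 1 - adj EMQ) *v E\<psi> = (matrix_inv (mat 1 - adj EMQ) ** (mat 1 - adj EMQ)) *v \<theta>"
    by (simp add: adj flip: matrix_vector_mul_assoc)
  then show ?thesis
    using invertible_one_minus_EMQ by (simp add: adj invertible_adj matrix_inv_mult(2))
qed

lemma adj_P1_E\<psi>: "adj P1 *v E\<psi> = \<theta>"
  by (rule cinner_eqI)
    (simp add: cinner_adj P1_eq_ketbra ketbra_mult_vec cinner_scale_right cinner_E\<psi>_\<psi>)

lemma average_\<psi>: "w \<in> space \<P> \<Longrightarrow> 0 < N \<Longrightarrow> average w N *v \<psi> = \<psi>"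
  by (simp add: average_def scaleR_matrix_vector_mult sum_matrix_vector_mult mat_prod_\<psi>
      sum_constant_scaleR del: sum_constant)

lemma average_tendsto: "AE w in \<P>. average w \<longlonglongrightarrow> P1"
  using average_mult_1_minus_A AE_space
proof eventually_elim
  case (elim w)
  let ?Z = "mat 1 - EMQ"
  \<comment> \<open>The averages fix \<open>\<psi>\<close>, so they leave the rank-one term
    unchanged. This needs \<open>0 < N\<close>, the average of length 0 being the zero
    matrix.\<close>
  have eq: "average w N ** ?Z = average w N ** (mat 1 - A) + ketbra \<psi> E\<psi>" if "0 < N" for N
    by (rule matrix_eqI, simp only: matrix_vector_mul_assoc[symmetric] one_minus_EMQ_vec
        matrix_vector_mult_add_rdistrib)
      (simp add: ketbra_mult_vec matrix_vector_mult_diff_rdistrib matrix_vector_right_distrib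
        vector_scalar_commute average_\<psi>[OF elim(2) that])
  have "\<forall>\<^sub>F N in sequentially. average w N ** (mat 1 - A) + ketbra \<psi> E\<psi> = average w N ** ?Z"
    using eventually_gt_at_top[of 0] by eventually_elim (simp add: eq)
  moreover have "(\<lambda>N. average w N ** (mat 1 - A) + ketbra \<psi> E\<psi>) \<longlonglongrightarrow> 0 + ketbra \<psi> E\<psi>"
    by (intro tendsto_add elim(1) tendsto_const)
  ultimately have "(\<lambda>N. average w N ** ?Z) \<longlonglongrightarrow> P1 ** ?Z"
    by (simp add: tendsto_cong P1_one_minus_EMQ)
  then have "(\<lambda>N. (average w N ** ?Z) ** matrix_inv ?Z) \<longlonglongrightarrow> (P1 ** ?Z) ** matrix_inv ?Z"
    by (rule tendsto_matrix_matrix_mult[OF _ tendsto_const])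
  moreover have "(X ** ?Z) ** matrix_inv ?Z = X" for X :: "complex^'n^'n"
    by (simp add: matrix_inv_mult[OF invertible_one_minus_EMQ] flip: matrix_mul_assoc)
  ultimately show ?case by (simp only:)
qed

end

text \<open>As \<open>matrix_inv\<close> is total, invertibility is asserted separately to give the
  resolvent formula its meaning.\<close>

theorem theorem3:
  fixes p :: "'a measure"
    and \<nu> :: "complex^'n \<Rightarrow> real"
    and \<psi>\<^sub>S :: "complex^'n"
    and M :: "'a \<Rightarrow> complex^'n^'n"
  assumes "RRDO p \<nu> \<psi>\<^sub>S M"
    and "measure p {\<omega> \<in> space p. M \<omega> \<in> M_E \<nu> \<psi>\<^sub>S} > 0"
  shows
    "let \<P> = (\<Pi>\<^sub>M j\<in>{1::nat..}. p);
         E_\<psi> = (\<integral>\<omega>. psi_of \<psi>\<^sub>S (M \<omega>) \<partial>p);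
         E_MQ = (\<integral>\<omega>. MQ_of \<psi>\<^sub>S (M \<omega>) \<partial>p);
         P1 = riesz_projection (\<integral>\<omega>. M \<omega> \<partial>p) 1;
         \<theta> = matrix_inv (mat 1 - adj E_MQ) *v E_\<psi>
     in invertible (mat 1 - adj E_MQ) \<and>
        \<theta> = adj P1 *v E_\<psi> \<and>
        \<theta> = adj P1 *v \<psi>\<^sub>S \<and>
        ketbra \<psi>\<^sub>S \<theta> = P1 \<and>
        (\<exists>\<Omega>\<^sub>3 \<in> sets \<P>. measure \<P> \<Omega>\<^sub>3 = 1 \<and>
           (\<forall>w\<in>\<Omega>\<^sub>3. (\<lambda>N. (1 / real N) *\<^sub>R (\<Sum>n=1..N. mat_prod M w n)) \<longlonglongrightarrow> ketbra \<psi>\<^sub>S \<theta>))"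
proof -
  interpret prob_space p using assms(1) by (simp add: RRDO_def)
  interpret random_contraction p \<nu> \<psi>\<^sub>S M
    using assms by unfold_locales (auto simp: RRDO_def)
  interpret \<P>: prob_space \<P> by (rule prob_space_\<P>)
  \<comment> \<open>The exceptional set is enclosed in a measurable null set, whose complement
    serves as \<open>\<Omega>\<^sub>3\<close>.\<close>
  obtain N where N: "N \<in> null_sets \<P>" "{w \<in> space \<P>. \<not> average w \<longlonglongrightarrow> P1} \<subseteq> N"
    using average_tendsto by (auto simp: eventually_ae_filter)
  have "\<P>.prob (space \<P> - N) = 1"
    using N(1) by (subst \<P>.prob_compl) (auto simp: measure_eq_0_null_sets)
  moreover have "average w \<longlonglongrightarrow> P1" if "w \<in> space \<P> - N" for w
    using N(2) that by blast
  ultimately have "\<exists>\<Omega>\<^sub>3\<in>sets \<P>. \<P>.prob \<Omega>\<^sub>3 = 1 \<and> (\<forall>w\<in>\<Omega>\<^sub>3. average w \<longlonglongrightarrow> ketbra \<psi>\<^sub>S \<theta>)"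
    using N(1) P1_eq_ketbra by (intro bexI[of _ "space \<P> - N"]) auto
  moreover have "invertible (mat 1 - adj EMQ)"
    using invertible_one_minus_EMQ invertible_adj[of "mat 1 - EMQ"] by (simp add: adj_diff)
  ultimately show ?thesis
    unfolding Let_def A_def[symmetric] P1_def[symmetric] E\<psi>_def[symmetric] EMQ_def[symmetric]
      \<theta>_eq_resolvent adj_P1_E\<psi> average_def[symmetric, abs_def]
    by (simp add: \<theta>_def[symmetric] P1_eq_ketbra[symmetric] average_def[abs_def])
qed

end
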